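(* Let $N\ge2$, $s\in(1/2,1)$, $q_1,q_2>1$, and let $V\colon(0,+\infty)\to[0,+\infty)$ and $K\colon(0,+\infty)\to(0,+\infty)$ be continuous. If \[ \lim_{R\to0^+}\mathcal S_0(q_1,R)=\lim_{R\to+\infty}\mathcal S_\infty(q_2,R)=0, \] then $H^s_{V,\mathrm{rad}}(\mathbb{R}^N)$ is compactly embedded into $L^{q_1}_K(\mathbb{R}^N)+L^{q_2}_K(\mathbb{R}^N)$.
   Context: $B_R$ is the open ball of radius $R$ centered at the origin, $B_R^c$ its complement. For $0<s<1$, $2^*_s=\frac{2N}{N-2s}$, $C(N,s)=\left(\int_{\mathbb{R}^N}\frac{1-\cos\zeta_1}{|\zeta|^{N+2s}}d\zeta\right)^{-1}$, $[u]_{H^s}=\left(\frac{C(N,s)}{2}\iint_{\mathbb{R}^N\times\mathbb{R}^N}\frac{|u(x)-u(y)|^2}{|x-y|^{N+2s}}dx\,dy\right)^{1/2}$, $\dot H^s(\mathbb{R}^N)=\{u\in L^{2^*_s}(\mathbb{R}^N):[u]_{H^s}<\infty\}$, $H^s_V(\mathbb{R}^N)=\{u\in\dot H^s(\mathbb{R}^N):\int V(|x|)|u|^2dx<\infty\}$ with norm $\|u\|^2=[u]_{H^s}^2+\int_{\mathbb{R}^N}V(|x|)|u|^2dx$, and $H^s_{V,\mathrm{rad}}(\mathbb{R}^N)$ is the subspace of radial functions. $L^q_K(\mathbb{R}^N)=L^q(\mathbb{R}^N,K(|x|)dx)$, and $L^{q_1}_K+L^{q_2}_K=\{u_1+u_2:u_i\in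 L^{q_i}_K\}$ with norm $\inf_{u=u_1+u_2}\max\{\|u_1\|_{L^{q_1}_K},\|u_2\|_{L^{q_2}_K}\}$. For $q>1$, $R>0$: $\mathcal S_0(q,R)=\sup\{\int_{B_R}K(|x|)|u|^qdx: u\in H^s_{V,\mathrm{rad}},\|u\|=1\}$ and $\mathcal S_\infty(q,R)=\sup\{\int_{B_R^c}K(|x|)|u|^qdx: u\in H^s_{V,\mathrm{rad}},\|u\|=1\}$. *)

theory Defs
  imports "HOL-Analysis.Analysis"
begin

definition first_basis :: "'a::euclidean_space" where
  "first_basis = (SOME b. b \<in> Basis)"

definition frac_const :: "'a::euclidean_space itself \<Rightarrow> real \<Rightarrow> real" where
  "frac_const T s = inverse (enn2real (\<integral>\<^sup>+ z. ennreal ((1 - cos (z \<bullet> (first_basis::'a)))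
        / norm z powr (real DIM('a) + 2 * s)) \<partial>(lborel::'a measure)))"

definition gagliardo_sq :: "real \<Rightarrow> ('a::euclidean_space \<Rightarrow> real) \<Rightarrow> ennreal" where
  "gagliardo_sq s u = ennreal (frac_const TYPE('a) s / 2) *
     (\<integral>\<^sup>+ p. ennreal ((u (fst p) - u (snd p))^2 / norm (fst p - snd p) powr (real DIM('a) + 2 * s))
        \<partial>(lborel \<Otimes>\<^sub>M lborel))"

definition frac_crit :: "'a::euclidean_space itself \<Rightarrow> real \<Rightarrow> real" where
  "frac_crit T s = 2 * real DIM('a) / (real DIM('a) - 2 * s)"

definition dotH :: "real \<Rightarrow> ('a::euclidean_space \<Rightarrow> real) set" where
  "dotH s = {u. u \<in> borel_measurable lborel
     \<and> (\<integral>\<^sup>+ x. ennreal (\<bar>u x\<bar> powr frac_crit TYPE('a) s) \<partial>lborel) < \<infinity>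
     \<and> gagliardo_sq s u < \<infinity>}"

definition V_integral :: "(real \<Rightarrow> real) \<Rightarrow> ('a::euclidean_space \<Rightarrow> real) \<Rightarrow> ennreal" where
  "V_integral V u = (\<integral>\<^sup>+ x. ennreal (V (norm x) * (u x)^2) \<partial>lborel)"

definition HsV :: "real \<Rightarrow> (real \<Rightarrow> real) \<Rightarrow> ('a::euclidean_space \<Rightarrow> real) set" where
  "HsV s V = {u \<in> dotH s. V_integral V u < \<infinity>}"

definition radial :: "('a::euclidean_space \<Rightarrow> real) \<Rightarrow> bool" where
  "radial u \<longleftrightarrow> (\<forall>x y. norm x = norm y \<longrightarrow> u x = u y)"

definition HsV_rad :: "real \<Rightarrow> (real \<Rightarrow> real) \<Rightarrow> ('a::euclidean_space \<Rightarrow> real) set" where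
  "HsV_rad s V = {u \<in> HsV s V. radial u}"

definition HsV_norm :: "real \<Rightarrow> (real \<Rightarrow> real) \<Rightarrow> ('a::euclidean_space \<Rightarrow> real) \<Rightarrow> real" where
  "HsV_norm s V u = sqrt (enn2real (gagliardo_sq s u + V_integral V u))"

definition LqK :: "real \<Rightarrow> (real \<Rightarrow> real) \<Rightarrow> ('a::euclidean_space \<Rightarrow> real) set" where
  "LqK q K = {u. u \<in> borel_measurable lborel
     \<and> (\<integral>\<^sup>+ x. ennreal (K (norm x) * \<bar>u x\<bar> powr q) \<partial>lborel) < \<infinity>}"

definition LqK_norm :: "real \<Rightarrow> (real \<Rightarrow> real) \<Rightarrow> ('a::euclidean_space \<Rightarrow> real) \<Rightarrow> real" where
  "LqK_norm q K u = enn2real (\<integral>\<^sup>+ x. ennreal (K (norm x) * \<bar>u x\<bar> powr q) \<partial>lborel) powr (1 / q)"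

definition LqK_sum :: "real \<Rightarrow> real \<Rightarrow> (real \<Rightarrow> real) \<Rightarrow> ('a::euclidean_space \<Rightarrow> real) set" where
  "LqK_sum q1 q2 K = {u. \<exists>u1 u2. u1 \<in> LqK q1 K \<and> u2 \<in> LqK q2 K \<and> u = (\<lambda>x. u1 x + u2 x)}"

definition LqK_sum_norm :: "real \<Rightarrow> real \<Rightarrow> (real \<Rightarrow> real) \<Rightarrow> ('a::euclidean_space \<Rightarrow> real) \<Rightarrow> real" where
  "LqK_sum_norm q1 q2 K u = Inf {max (LqK_norm q1 K u1) (LqK_norm q2 K u2) | u1 u2.
      u1 \<in> LqK q1 K \<and> u2 \<in> LqK q2 K \<and> u = (\<lambda>x. u1 x + u2 x)}"

definition S0 :: "'a::euclidean_space itself \<Rightarrow> real \<Rightarrow> (real \<Rightarrow> real) \<Rightarrow> (real \<Rightarrow> real) \<Rightarrow> real \<Rightarrow> real \<Rightarrow> ennreal" where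
  "S0 T s V K q R = Sup {(\<integral>\<^sup>+ x. ennreal (K (norm x) * \<bar>u x\<bar> powr q) * indicator (ball 0 R) x \<partial>lborel)
      | u :: 'a \<Rightarrow> real. u \<in> HsV_rad s V \<and> HsV_norm s V u = 1}"

definition Sinf :: "'a::euclidean_space itself \<Rightarrow> real \<Rightarrow> (real \<Rightarrow> real) \<Rightarrow> (real \<Rightarrow> real) \<Rightarrow> real \<Rightarrow> real \<Rightarrow> ennreal" where
  "Sinf T s V K q R = Sup {(\<integral>\<^sup>+ x. ennreal (K (norm x) * \<bar>u x\<bar> powr q) * indicator (- ball 0 R) x \<partial>lborel)
      | u :: 'a \<Rightarrow> real. u \<in> HsV_rad s V \<and> HsV_norm s V u = 1}"

definition compact_embedding_rad :: "'a::euclidean_space itself \<Rightarrow> real \<Rightarrow> (real \<Rightarrow> real) \<Rightarrow> (real \<Rightarrow> real) \<Rightarrow> real \<Rightarrow> real \<Rightarrow> bool" where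
  "compact_embedding_rad T s V K q1 q2 \<longleftrightarrow>
     (HsV_rad s V :: ('a \<Rightarrow> real) set) \<subseteq> LqK_sum q1 q2 K
   \<and> (\<exists>C. \<forall>u::'a \<Rightarrow> real. u \<in> HsV_rad s V \<longrightarrow> LqK_sum_norm q1 q2 K u \<le> C * HsV_norm s V u)
   \<and> (\<forall>f :: nat \<Rightarrow> 'a \<Rightarrow> real. (\<forall>n. f n \<in> HsV_rad s V) \<and> bounded (range (\<lambda>n. HsV_norm s V (f n)))
        \<longrightarrow> (\<exists>r u. strict_mono r \<and> u \<in> LqK_sum q1 q2 K
               \<and> (\<lambda>n. LqK_sum_norm q1 q2 K (\<lambda>x. f (r n) x - u x)) \<longlonglongrightarrow> 0))"

end

theory Submission
  imports Defs "HOL-Library.Diagonal_Subsequence"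
begin

text \<open>
  Since \<open>s > 1/2\<close>, a radial function of finite Gagliardo energy behaves away from the origin like a
  one-dimensional \<open>H\<^sup>s\<close> function: Campanato's argument on spherical shells shows that it is almost everywhere
  close to a constant on a thin shell and, as \<open>2 * s < DIM('a)\<close>, that it is bounded by a multiple of the norm on
  \<open>{x. norm x > a}\<close> for every \<open>a > 0\<close>. A diagonal choice over a countable family of shells
  therefore gives every bounded sequence an almost everywhere convergent subsequence, and dominated convergence applies
  on annuli. Near the origin and near infinity the hypotheses on \<open>S0\<close> and \<open>Sinf\<close>, applied to differences of two
  terms of the sequence and combined with Fatou's lemma, make the remaining integrals small. The limit need not
  lie in the Sobolev space, so no weak compactness is needed.
\<close>

section \<open>Radial functions on thin cones\<close>

text \<open>The obstacle is to extract one-dimensional information from an N-dimensional energy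
  without polar coordinates. Pairs of points of a shell of inner radius r and thickness l are kept
  only if both lie near a common ray, within an angle of order l / r. Such pairs have distance of
  order l, and by radial symmetry they lose only a factor of order (l / r)^(N-1) of the double
  integral. This yields the exponents of the oscillation bound: r^((1-N)/2) from the area of the
  sphere, and l^(s-1/2), the exponent of one-dimensional fractional regularity. Functions are
  concrete, not classes, so every pointwise estimate holds only almost everywhere; facts about
  constants are recovered by evaluating at a common good point of a shell of positive measure. Two
  degenerate situations need care. The norm controls the energy only if the normalising constant is
  neither 0 nor the inverse of infinity, and the suprema \<open>S0\<close> and \<open>Sinf\<close>
  say nothing directly about functions of norm zero or about limits outside the space.\<close>

definition axial_cone :: "real \<Rightarrow> 'a::euclidean_space \<Rightarrow> 'a set" where
  "axial_cone h e = {y. norm (y - norm y *\<^sub>R e) \<le> h * norm y}"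

lemma axial_cone_borel [measurable]: "axial_cone h e \<in> sets borel"
  unfolding axial_cone_def by measurable

text \<open>The cone is invariant under positive dilations, so Lebesgue measure scales as for full
  balls. Hence the cone occupies the same fraction of every ball centred at the origin.\<close>

lemma emeasure_cone_ball:
  fixes e :: "'a::euclidean_space"
  assumes "t > 0"
  shows "emeasure lborel (axial_cone h e \<inter> ball 0 t) = ennreal (t ^ DIM('a)) * emeasure lborel (axial_cone h e \<inter> ball 0 1)"
proof -
  have "(\<lambda>x. t *\<^sub>R x + 0) ` (axial_cone h e \<inter> ball 0 1) = axial_cone h e \<inter> ball 0 t"
  proof (intro equalityI subsetI)
    fix y assume "y \<in> (\<lambda>x. t *\<^sub>R x + 0) ` (axial_cone h e \<inter> ball 0 1)"
    then obtain x where x: "y = t *\<^sub>R x" "x \<in> axial_cone h e" "norm x < 1" by force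
    have "norm (y - norm y *\<^sub>R e) = t * norm (x - norm x *\<^sub>R e)"
    proof -
      have "y - norm y *\<^sub>R e = t *\<^sub>R (x - norm x *\<^sub>R e)"
        using assms by (simp add: x(1) scaleR_diff_right)
      then show ?thesis using assms by simp
    qed
    then show "y \<in> axial_cone h e \<inter> ball 0 t"
      using x assms by (auto simp: axial_cone_def mult_left_mono)
  next
    fix y assume y: "y \<in> axial_cone h e \<inter> ball 0 t"
    define x where "x = inverse t *\<^sub>R y"
    have xy: "y = t *\<^sub>R x" using assms by (simp add: x_def)
    have eq: "norm (y - norm y *\<^sub>R e) = t * norm (x - norm x *\<^sub>R e)"
    proof -
      have "y - norm y *\<^sub>R e = t *\<^sub>R (x - norm x *\<^sub>R e)"
        using assms by (simp add: xy scaleR_diff_right)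
      then show ?thesis using assms by simp
    qed
    have "t * norm (x - norm x *\<^sub>R e) \<le> t * (h * norm x)"
      using y eq assms by (simp add: axial_cone_def xy mult_ac)
    then have "x \<in> axial_cone h e" using assms by (simp add: axial_cone_def)
    moreover have "norm x < 1" using y assms by (simp add: xy)
    ultimately show "y \<in> (\<lambda>x. t *\<^sub>R x + 0) ` (axial_cone h e \<inter> ball 0 1)"
      using xy by (auto simp: image_iff)
  qed
  then show ?thesis
    using emeasure_lebesgue_affine[of t 0 "axial_cone h e \<inter> ball 0 1"] assms by (simp add: ennreal_power)
qed

lemma emeasure_ball_ennreal:
  fixes c :: "'a::euclidean_space"
  assumes "r \<ge> 0"
  shows "emeasure lborel (ball c r) = ennreal (unit_ball_vol DIM('a) * r ^ DIM('a))"
  using emeasure_ball[OF assms, of c] by simp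

text \<open>About \<open>1 / h\<close> disjoint balls of radius \<open>h / 8\<close> with centres on the axis fit into the cone.\<close>

lemma emeasure_cone_lower:
  fixes e :: "'a::euclidean_space"
  assumes e: "norm e = 1" and h: "0 < h" "h \<le> 1"
  shows "ennreal (unit_ball_vol DIM('a) * (h ^ (DIM('a) - 1) / 8 ^ DIM('a))) \<le> emeasure lborel (axial_cone h e \<inter> ball 0 1)"
proof -
  define d where "d = h / 8"
  define m where "m = nat \<lfloor>1 / h\<rfloor> + 1"
  \<comment> \<open>The spacing \<open>2 * d\<close> equals the diameter, so the open balls are
    disjoint. At most \<open>1 / h\<close> steps of length \<open>h / 4\<close> keep the centres at
    norms between 1/2 and 3/4, where the cone is wide enough for radius \<open>d\<close>.\<close>
  define z where "z k = (1/2 + 2 * d * real k) *\<^sub>R e" for k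
  have d: "d > 0" "d \<le> 1/8" using h by (auto simp: d_def)
  have hN: "h ^ DIM('a) = h * h ^ (DIM('a) - 1)"
    using DIM_positive[where 'a='a] by (metis power_minus_mult mult.commute)
  have kb: "d * real k \<le> 1/8" if "k < m" for k
  proof -
    have "real k \<le> 1 / h" using that h unfolding m_def by (simp add: less_Suc_eq_le le_nat_iff le_floor_iff)
    then show ?thesis using h by (simp add: d_def field_simps)
  qed
  have sub: "ball (z k) d \<subseteq> axial_cone h e \<inter> ball 0 1" if k: "k < m" for k
  proof
    fix y assume y: "y \<in> ball (z k) d"
    define t where "t = 1/2 + 2 * d * real k"
    have t: "1/2 \<le> t" "t \<le> 3/4" using kb[OF k] d by (auto simp: t_def)
    have yt: "norm (y - t *\<^sub>R e) < d" using y by (simp add: z_def t_def dist_norm norm_minus_commute)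
    have nt: "norm (t *\<^sub>R e) = t" using t e by simp
    have a: "\<bar>norm y - t\<bar> < d" using norm_triangle_ineq3[of y "t *\<^sub>R e"] yt nt by linarith
    have "norm (y - norm y *\<^sub>R e) \<le> norm (y - t *\<^sub>R e) + norm (t *\<^sub>R e - norm y *\<^sub>R e)"
      by (metis (no_types) add.commute diff_add_cancel add_diff_eq norm_triangle_ineq)
    also have "norm (t *\<^sub>R e - norm y *\<^sub>R e) = \<bar>norm y - t\<bar>"
      using e by (simp add: scaleR_diff_left[symmetric])
    finally have "norm (y - norm y *\<^sub>R e) \<le> 2 * d" using yt a by linarith
    also have "\<dots> \<le> h * (3/8)" using h by (simp add: d_def)
    also have "\<dots> \<le> h * norm y" using a t d h by (intro mult_left_mono) auto
    finally show "y \<in> axial_cone h e \<inter> ball 0 1" using a t d by (auto simp: axial_cone_def)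
  qed
  have disj: "disjoint_family_on (\<lambda>k. ball (z k) d) {..<m}"
  proof (unfold disjoint_family_on_def, intro ballI impI)
    fix k l :: nat assume kl: "k \<noteq> l"
    have "dist (z k) (z l) = 2 * d * \<bar>real k - real l\<bar>"
      using e d by (simp add: dist_norm z_def scaleR_diff_left[symmetric] abs_mult right_diff_distrib[symmetric])
    also have "\<dots> \<ge> 2 * d * 1" using kl d by (intro mult_left_mono) auto
    finally have "2 * d \<le> dist (z k) (z l)" by simp
    then show "ball (z k) d \<inter> ball (z l) d = {}" by (intro disjoint_ballI) simp
  qed
  have "1 / h \<le> real m" using h unfolding m_def by linarith
  then have "(1 / h) * (unit_ball_vol DIM('a) * d ^ DIM('a)) \<le> real m * (unit_ball_vol DIM('a) * d ^ DIM('a))"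
    using d by (intro mult_right_mono) auto
  moreover have "(1 / h) * (unit_ball_vol DIM('a) * d ^ DIM('a)) = unit_ball_vol DIM('a) * (h ^ (DIM('a) - 1) / 8 ^ DIM('a))"
    using h hN by (simp add: d_def power_divide field_simps)
  ultimately have "ennreal (unit_ball_vol DIM('a) * (h ^ (DIM('a) - 1) / 8 ^ DIM('a))) \<le> ennreal (real m * (unit_ball_vol DIM('a) * d ^ DIM('a)))"
    by (intro ennreal_leI) simp
  also have "\<dots> = (\<Sum>k<m. emeasure lborel (ball (z k) d))"
    using d by (simp add: emeasure_ball_ennreal ennreal_mult ennreal_of_nat_eq_real_of_nat)
  also have "\<dots> = emeasure lborel (\<Union>k<m. ball (z k) d)"
    by (rule sum_emeasure) (use disj in auto)
  also have "\<dots> \<le> emeasure lborel (axial_cone h e \<inter> ball 0 1)"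
    using sub by (intro emeasure_mono) auto
  finally show ?thesis .
qed

text \<open>Since the cone has the same share \<open>q\<close> of all centred balls, the images
  under the norm of Lebesgue measure on the cone and on the whole space are proportional. Integrals
  of radial functions are then proportional with factor \<open>q\<close>, which the packing of balls
  bounds from below.\<close>

lemma nn_integral_cone:
  fixes e :: "'a::euclidean_space" and F :: "real \<Rightarrow> ennreal"
  assumes e: "norm e = 1" and h: "0 < h" "h \<le> 1" and F [measurable]: "F \<in> borel_measurable borel"
  shows "ennreal (h ^ (DIM('a) - 1) / 8 ^ DIM('a)) * (\<integral>\<^sup>+y. F (norm (y::'a)) \<partial>lborel)
     \<le> (\<integral>\<^sup>+y. F (norm y) * indicator (axial_cone h e) y \<partial>lborel)"
proof -
  define B where "B = unit_ball_vol (real DIM('a))"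
  have B: "B > 0" by (simp add: B_def)
  define q where "q = measure lborel (axial_cone h e \<inter> ball 0 1) / B"
  have fin: "emeasure lborel (axial_cone h e \<inter> ball 0 1) < \<infinity>"
    using emeasure_mono[of "axial_cone h e \<inter> ball 0 1" "ball 0 1" lborel]
    by (simp add: emeasure_ball_ennreal order_le_less_trans)
  have q0: "q \<ge> 0" using B by (simp add: q_def)
  have mq: "emeasure lborel (axial_cone h e \<inter> ball 0 1) = ennreal (q * B)"
    using fin B by (simp add: q_def emeasure_eq_ennreal_measure)
  have hq: "h ^ (DIM('a) - 1) / 8 ^ DIM('a) \<le> q"
  proof -
    have "B * (h ^ (DIM('a) - 1) / 8 ^ DIM('a)) \<le> q * B"
      using emeasure_cone_lower[OF e h] q0 B unfolding mq B_def[symmetric]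
      by (subst (asm) ennreal_le_iff) auto
    then show ?thesis using B by (metis mult.commute mult_le_cancel_left_pos)
  qed
  \<comment> \<open>The minus sign makes the preimages of the half-lines \<open>{x<..}\<close>
    balls. These have finite measure, as the uniqueness of a measure determined by half-lines
    requires.\<close>
  define M1 where "M1 = distr (density lborel (indicator (axial_cone h e))) borel (\<lambda>y::'a. - norm y)"
  define M2 where "M2 = density (distr lborel borel (\<lambda>y::'a. - norm y)) (\<lambda>_. ennreal q)"
  have im: "(\<lambda>y::'a. - norm y) -` {x<..} = ball 0 (- x)" for x by (auto simp: dist_norm)
  have e1: "emeasure M1 {x<..} = emeasure lborel (axial_cone h e \<inter> ball 0 (- x))" for x
    by (simp add: M1_def emeasure_distr im emeasure_density indicator_inter_arith[symmetric] Int_commute)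
  have e2: "emeasure M2 {x<..} = ennreal q * emeasure lborel (ball (0::'a) (- x))" for x
    by (simp add: M2_def emeasure_density emeasure_distr im nn_integral_cmult)
  have eq: "emeasure M1 {x<..} = emeasure M2 {x<..}" for x
  proof (cases "x < 0")
    case True
    then have "emeasure M1 {x<..} = ennreal ((- x) ^ DIM('a)) * ennreal (q * B)"
      using emeasure_cone_ball[of "- x" h e] by (simp add: e1 mq)
    also have "\<dots> = emeasure M2 {x<..}"
      using True q0 B by (simp add: e2 emeasure_ball_ennreal B_def[symmetric] ennreal_mult[symmetric] mult_ac)
    finally show ?thesis .
  next
    case False
    then have empty: "ball (0::'a) (- x) = {}" by simp
    show ?thesis unfolding e1 e2 empty by simp
  qed
  have fin2: "emeasure M1 {x<..} < \<infinity>" for x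
  proof -
    have "emeasure M1 {x<..} \<le> emeasure lborel (ball (0::'a) (- x))"
      unfolding e1 by (intro emeasure_mono) auto
    also have "\<dots> < \<infinity>" by (intro emeasure_bounded_finite) simp
    finally show ?thesis .
  qed
  have MM: "M1 = M2"
    by (rule measure_eqI_lessThan) (use eq fin2 in \<open>auto simp: M1_def M2_def\<close>)
  have "ennreal (h ^ (DIM('a) - 1) / 8 ^ DIM('a)) * (\<integral>\<^sup>+y. F (norm (y::'a)) \<partial>lborel)
     \<le> ennreal q * (\<integral>\<^sup>+y. F (norm (y::'a)) \<partial>lborel)"
    by (intro mult_right_mono ennreal_leI hq) simp
  also have "\<dots> = (\<integral>\<^sup>+t. F (- t) \<partial>M2)"
    by (simp add: M2_def nn_integral_density nn_integral_cmult nn_integral_distr)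
  also have "\<dots> = (\<integral>\<^sup>+t. F (- t) \<partial>M1)" by (simp add: MM)
  also have "\<dots> = (\<integral>\<^sup>+y. F (norm y) * indicator (axial_cone h e) y \<partial>lborel)"
    by (simp add: M1_def nn_integral_density nn_integral_distr mult.commute)
  finally show ?thesis .
qed

section \<open>Mean oscillation on spherical shells\<close>

text \<open>Half-open, so that cutting a shell at its middle radius gives a disjoint union of two
  shells of half the thickness.\<close>

definition shell :: "real \<Rightarrow> real \<Rightarrow> 'a::euclidean_space set" where
  "shell r l = {x. r < norm x \<and> norm x \<le> r + l}"

lemma shell_borel [measurable]: "shell r l \<in> sets borel"
  unfolding shell_def by measurable

lemma power_diff_le_mult:
  fixes a b :: real
  assumes "0 \<le> a" "a \<le> b"
  shows "b ^ n - a ^ n \<le> real n * b ^ (n - 1) * (b - a)"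
proof (induction n)
  case (Suc n)
  have "b * (b ^ n - a ^ n) \<le> b * (real n * b ^ (n - 1) * (b - a))"
    using Suc assms by (intro mult_left_mono) auto
  also have "\<dots> = real n * b ^ n * (b - a)" by (cases n) auto
  finally have "b * (b ^ n - a ^ n) \<le> real n * b ^ n * (b - a)" .
  moreover have "a ^ n * (b - a) \<le> b ^ n * (b - a)"
    using assms by (intro mult_right_mono power_mono) auto
  ultimately show ?case by (simp add: algebra_simps)
qed simp

lemma emeasure_shell:
  assumes "0 < r" "0 < l"
  shows "emeasure lborel (shell r l :: 'a::euclidean_space set) = ennreal (measure lborel (shell r l :: 'a set))"
    and "measure lborel (shell r l :: 'a set) = unit_ball_vol DIM('a) * ((r + l) ^ DIM('a) - r ^ DIM('a))"
proof -
  have eq: "shell r l = cball (0::'a) (r + l) - cball 0 r" by (auto simp: shell_def)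
  have "emeasure lborel (shell r l :: 'a set) \<le> emeasure lborel (cball (0::'a) (r + l))"
    unfolding eq by (intro emeasure_mono) auto
  also have "\<dots> < \<infinity>" by (intro emeasure_bounded_finite) simp
  finally show "emeasure lborel (shell r l :: 'a set) = ennreal (measure lborel (shell r l :: 'a set))"
    by (simp add: emeasure_eq_ennreal_measure)
  have "measure lborel (shell r l :: 'a set) = measure lborel (cball (0::'a) (r + l)) - measure lborel (cball (0::'a) r)"
    unfolding eq by (rule measure_Diff) (use assms in \<open>auto simp: emeasure_cball\<close>)
  also have "\<dots> = unit_ball_vol DIM('a) * ((r + l) ^ DIM('a) - r ^ DIM('a))"
    using assms by (simp add: measure_def emeasure_cball algebra_simps)
  finally show "measure lborel (shell r l :: 'a set) = unit_ball_vol DIM('a) * ((r + l) ^ DIM('a) - r ^ DIM('a))" .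
qed

text \<open>Volume is comparable to area of the sphere times thickness: the area factor varies only
  between radius \<open>r\<close> and the outer radius, which is at most
  \<open>4 * r\<close>.\<close>

lemma measure_shell_bounds:
  assumes "0 < r" "0 < l" "l \<le> 3 * r"
  shows "unit_ball_vol DIM('a) * r ^ (DIM('a) - 1) * l \<le> measure lborel (shell r l :: 'a::euclidean_space set)"
    and "measure lborel (shell r l :: 'a set) \<le> unit_ball_vol DIM('a) * (real DIM('a) * (4 * r) ^ (DIM('a) - 1) * l)"
proof -
  have p: "x ^ DIM('a) = x * x ^ (DIM('a) - 1)" for x :: real
    using DIM_positive[where 'a='a] by (metis power_minus_mult mult.commute)
  have "(r + l) * r ^ (DIM('a) - 1) \<le> (r + l) * (r + l) ^ (DIM('a) - 1)"
    using assms by (intro mult_left_mono power_mono) auto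
  then have "r ^ (DIM('a) - 1) * l \<le> (r + l) ^ DIM('a) - r ^ DIM('a)"
    by (subst (1 2) p) (simp add: algebra_simps)
  then show "unit_ball_vol DIM('a) * r ^ (DIM('a) - 1) * l \<le> measure lborel (shell r l :: 'a set)"
    unfolding emeasure_shell(2)[OF assms(1,2), where 'a='a] mult.assoc by (intro mult_left_mono) auto
  have "(r + l) ^ DIM('a) - r ^ DIM('a) \<le> real DIM('a) * (r + l) ^ (DIM('a) - 1) * l"
    using power_diff_le_mult[of r "r + l" "DIM('a)"] assms by simp
  also have "\<dots> \<le> real DIM('a) * (4 * r) ^ (DIM('a) - 1) * l"
    using assms by (intro mult_left_mono mult_right_mono power_mono) auto
  finally show "measure lborel (shell r l :: 'a set) \<le> unit_ball_vol DIM('a) * (real DIM('a) * (4 * r) ^ (DIM('a) - 1) * l)"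
    unfolding emeasure_shell(2)[OF assms(1,2), where 'a='a] by (intro mult_left_mono) auto
qed

text \<open>The energy without its normalising factor. Shell estimates are made for this quantity,
  and the factor enters again only through its positivity.\<close>

definition gagliardo_int :: "real \<Rightarrow> ('a::euclidean_space \<Rightarrow> real) \<Rightarrow> ennreal" where
  "gagliardo_int s u = (\<integral>\<^sup>+ p. ennreal ((u (fst p) - u (snd p))^2 / norm (fst p - snd p) powr (real DIM('a) + 2 * s))
        \<partial>(lborel \<Otimes>\<^sub>M lborel))"

lemma gagliardo_int_iterated:
  fixes u :: "'a::euclidean_space \<Rightarrow> real"
  assumes [measurable]: "u \<in> borel_measurable borel"
  shows "gagliardo_int s u = (\<integral>\<^sup>+ x. \<integral>\<^sup>+ y. ennreal ((u x - u y)^2 / norm (x - y) powr (real DIM('a) + 2 * s)) \<partial>lborel \<partial>lborel)"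
proof -
  have "(\<lambda>p. ennreal ((u (fst p) - u (snd p))^2 / norm (fst p - snd p) powr (real DIM('a) + 2 * s)))
    \<in> borel_measurable (lborel \<Otimes>\<^sub>M lborel)" by measurable
  from lborel.nn_integral_fst[OF this] show ?thesis by (simp add: gagliardo_int_def)
qed

text \<open>The profile is the restriction of \<open>u\<close> to a coordinate axis; it is
  measurable because \<open>u\<close> is Borel, not merely Lebesgue, measurable.\<close>

lemma radial_profile:
  fixes u :: "'a::euclidean_space \<Rightarrow> real"
  assumes [measurable]: "u \<in> borel_measurable borel" and "radial u"
  obtains v where "v \<in> borel_measurable borel" "\<And>x. u x = v (norm x)"
proof -
  obtain b :: 'a where b: "b \<in> Basis" using nonempty_Basis by blast
  show ?thesis
  proof
    show "(\<lambda>t. u (t *\<^sub>R b)) \<in> borel_measurable borel" by measurable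
    show "u x = u (norm x *\<^sub>R b)" for x
      using assms(2) b unfolding radial_def by (metis norm_scaleR norm_Basis abs_norm_cancel mult.right_neutral)
  qed
qed

text \<open>For fixed \<open>x\<close> the integral over the shell is, by radial symmetry, a multiple of the integral over the part of the
  shell in a thin cone around \<open>x\<close>, where \<open>norm (x - y)\<close> is comparable to the thickness of the shell.\<close>

lemma shell_double_integral_le:
  fixes u :: "'a::euclidean_space \<Rightarrow> real"
  assumes u [measurable]: "u \<in> borel_measurable borel" and rad: "radial u"
    and rl: "0 < r" "0 < l" "l \<le> 3 * r" and s: "0 < s"
  shows "ennreal ((l / (3 * r)) ^ (DIM('a) - 1) / 8 ^ DIM('a)) *
      (\<integral>\<^sup>+ x. \<integral>\<^sup>+ y. ennreal ((u x - u y)^2) * indicator (shell r l) y * indicator (shell r l) x \<partial>lborel \<partial>lborel)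
    \<le> ennreal ((3 * l) powr (real DIM('a) + 2 * s)) * gagliardo_int s u"
proof -
  obtain v where [measurable]: "v \<in> borel_measurable borel" and v: "\<And>x. u x = v (norm x)"
    using radial_profile[OF u rad] by blast
  \<comment> \<open>Radii in the shell are at most \<open>4 * r\<close>, so a point in the cone is
    within \<open>h * (4 * r) = 4 / 3 * l\<close> of its axis. With a radial difference of at most
    \<open>l\<close>, the distance to \<open>x\<close> stays below \<open>3 * l\<close>.\<close>
  define h where "h = l / (3 * r)"
  have h: "0 < h" "h \<le> 1" using rl by (auto simp: h_def)
  let ?p = "real DIM('a) + 2 * s"
  have p: "?p > 0" using s by (simp add: add_nonneg_pos)
  let ?k = "\<lambda>x y. ennreal ((u x - u y)^2 / norm (x - y) powr ?p)"
  have inner: "ennreal (h ^ (DIM('a) - 1) / 8 ^ DIM('a)) * (\<integral>\<^sup>+ y. ennreal ((u x - u y)^2) * indicator (shell r l) y \<partial>lborel)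
      \<le> ennreal ((3 * l) powr ?p) * (\<integral>\<^sup>+ y. ?k x y \<partial>lborel)" if x: "x \<in> shell r l" for x
  proof -
    have x0: "norm x > 0" "r < norm x" "norm x \<le> r + l" using x rl by (auto simp: shell_def)
    define e where "e = (1 / norm x) *\<^sub>R x"
    have e: "norm e = 1" "norm x *\<^sub>R e = x" using x0 by (auto simp: e_def)
    define F where "F t = ennreal ((u x - v t)^2) * indicator {r<..r + l} t" for t
    have [measurable]: "F \<in> borel_measurable borel" unfolding F_def by measurable
    have F: "F (norm y) = ennreal ((u x - u y)^2) * indicator (shell r l) y" for y :: 'a
      by (auto simp: F_def v shell_def indicator_def)
    have pw: "F (norm y) * indicator (axial_cone h e) y \<le> ennreal ((3 * l) powr ?p) * ?k x y" for y :: 'a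
    proof (cases "y \<in> shell r l \<and> y \<in> axial_cone h e \<and> y \<noteq> x")
      case False
      then show ?thesis by (auto simp: F)
    next
      case True
      then have y: "r < norm y" "norm y \<le> r + l" "norm (y - norm y *\<^sub>R e) \<le> h * norm y" "norm (x - y) > 0"
        by (auto simp: shell_def axial_cone_def)
      have "norm (x - y) \<le> norm (x - norm y *\<^sub>R e) + norm (norm y *\<^sub>R e - y)"
        using norm_triangle_ineq[of "x - norm y *\<^sub>R e" "norm y *\<^sub>R e - y"] by simp
      also have "norm (x - norm y *\<^sub>R e) = norm ((norm x - norm y) *\<^sub>R e)"
        using e by (simp add: scaleR_diff_left)
      also have "\<dots> \<le> l" using e x0 y by simp
      also have "norm (norm y *\<^sub>R e - y) \<le> h * (4 * r)"
      proof -
        have "h * norm y \<le> h * (4 * r)" using h y rl by (intro mult_left_mono) auto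
        then show ?thesis using y by (simp add: norm_minus_commute)
      qed
      also have "h * (4 * r) = 4 / 3 * l" using rl by (simp add: h_def)
      finally have "norm (x - y) \<le> 3 * l" using rl by simp
      then have "norm (x - y) powr ?p \<le> (3 * l) powr ?p" using p by (intro powr_mono2) auto
      then have "(u x - u y)^2 * norm (x - y) powr ?p \<le> (u x - u y)^2 * (3 * l) powr ?p"
        by (intro mult_left_mono) auto
      then have "(u x - u y)^2 \<le> (3 * l) powr ?p * ((u x - u y)^2 / norm (x - y) powr ?p)"
        using y by (simp add: field_simps)
      then show ?thesis using True by (simp add: F ennreal_mult'[symmetric] ennreal_leI)
    qed
    have "ennreal (h ^ (DIM('a) - 1) / 8 ^ DIM('a)) * (\<integral>\<^sup>+ y. F (norm (y::'a)) \<partial>lborel)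
       \<le> (\<integral>\<^sup>+ y. F (norm y) * indicator (axial_cone h e) y \<partial>lborel)"
      by (rule nn_integral_cone) (use e h in auto)
    also have "\<dots> \<le> (\<integral>\<^sup>+ y. ennreal ((3 * l) powr ?p) * ?k x y \<partial>lborel)"
      by (intro nn_integral_mono pw)
    also have "\<dots> = ennreal ((3 * l) powr ?p) * (\<integral>\<^sup>+ y. ?k x y \<partial>lborel)"
      by (rule nn_integral_cmult) measurable
    finally show ?thesis by (simp add: F)
  qed
  have "ennreal (h ^ (DIM('a) - 1) / 8 ^ DIM('a)) *
      (\<integral>\<^sup>+ x. \<integral>\<^sup>+ y. ennreal ((u x - u y)^2) * indicator (shell r l) y * indicator (shell r l) x \<partial>lborel \<partial>lborel)
     = (\<integral>\<^sup>+ x. ennreal (h ^ (DIM('a) - 1) / 8 ^ DIM('a)) * ((\<integral>\<^sup>+ y. ennreal ((u x - u y)^2) * indicator (shell r l) y \<partial>lborel) * indicator (shell r l) x) \<partial>lborel)"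
    by (subst nn_integral_cmult[symmetric]) (auto simp: nn_integral_multc)
  also have "\<dots> \<le> (\<integral>\<^sup>+ x. ennreal ((3 * l) powr ?p) * (\<integral>\<^sup>+ y. ?k x y \<partial>lborel) \<partial>lborel)"
    by (intro nn_integral_mono) (use inner in \<open>auto simp: indicator_def\<close>)
  also have "\<dots> = ennreal ((3 * l) powr ?p) * gagliardo_int s u"
    by (simp add: nn_integral_cmult gagliardo_int_iterated)
  finally show ?thesis by (simp add: h_def)
qed

text \<open>The constant is chosen so that \<open>osc_bound\<close> times the lower bound for the volume of the shell squares to the
  bound of \<open>shell_double_integral_le\<close>.\<close>

definition osc_bound :: "'a::euclidean_space itself \<Rightarrow> real \<Rightarrow> real \<Rightarrow> real \<Rightarrow> real" where
  "osc_bound T s r l = sqrt (3 powr (2 * real DIM('a) + 2 * s - 1) * 8 ^ DIM('a)) / unit_ball_vol DIM('a)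
     * r powr ((1 - real DIM('a)) / 2) * l powr (s - 1/2)"

lemma osc_bound_pos: "0 < r \<Longrightarrow> 0 < l \<Longrightarrow> 0 < osc_bound TYPE('a::euclidean_space) s r l"
  by (simp add: osc_bound_def)

lemma osc_bound_identity:
  assumes "0 < r" "0 < l"
  shows "(osc_bound TYPE('a::euclidean_space) s r l * (unit_ball_vol DIM('a) * r ^ (DIM('a) - 1) * l))\<^sup>2
    * ((l / (3 * r)) ^ (DIM('a) - 1) / 8 ^ DIM('a)) = (3 * l) powr (real DIM('a) + 2 * s)"
proof -
  define n where "n = real DIM('a)"
  have pw: "x ^ (DIM('a) - 1) = x powr (n - 1)" if "x > 0" for x :: real
    using that DIM_positive[where 'a='a] unfolding n_def
    by (subst powr_realpow[symmetric]) (auto simp: of_nat_diff Suc_leI)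
  have B: "unit_ball_vol n > 0" by (simp add: n_def)
  have "(osc_bound TYPE('a) s r l * (unit_ball_vol DIM('a) * r ^ (DIM('a) - 1) * l))\<^sup>2
     = 3 powr (2 * n + 2 * s - 1) * 8 ^ DIM('a) * ((r powr ((1 - n) / 2))\<^sup>2 * (l powr (s - 1/2))\<^sup>2 * (r powr (n - 1))\<^sup>2 * l\<^sup>2)"
    unfolding osc_bound_def n_def[symmetric] pw[OF assms(1)] using B
    by (simp add: power_mult_distrib power_divide field_simps)
  also have "(r powr ((1 - n) / 2))\<^sup>2 * (l powr (s - 1/2))\<^sup>2 * (r powr (n - 1))\<^sup>2 * l\<^sup>2 = r powr (n - 1) * l powr (2 * s + 1)"
  proof -
    have r: "(r powr ((1 - n) / 2))\<^sup>2 * (r powr (n - 1))\<^sup>2 = r powr (n - 1)"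
      using assms by (simp add: power2_eq_square powr_add[symmetric])
    have "l\<^sup>2 = l powr 2" using assms by simp
    moreover have "(l powr (s - 1/2))\<^sup>2 = l powr (2 * s - 1)"
      using assms by (simp add: power2_eq_square powr_add[symmetric])
    ultimately have l: "(l powr (s - 1/2))\<^sup>2 * l\<^sup>2 = l powr (2 * s + 1)"
      by (simp only: powr_add[symmetric]) (simp add: add.commute)
    have "(r powr ((1 - n) / 2))\<^sup>2 * (l powr (s - 1/2))\<^sup>2 * (r powr (n - 1))\<^sup>2 * l\<^sup>2
      = ((r powr ((1 - n) / 2))\<^sup>2 * (r powr (n - 1))\<^sup>2) * ((l powr (s - 1/2))\<^sup>2 * l\<^sup>2)"
      by (simp only: mult_ac)
    then show ?thesis unfolding r l .
  qed
  finally have 1: "(osc_bound TYPE('a) s r l * (unit_ball_vol DIM('a) * r ^ (DIM('a) - 1) * l))\<^sup>2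
     = 3 powr (2 * n + 2 * s - 1) * 8 ^ DIM('a) * (r powr (n - 1) * l powr (2 * s + 1))" .
  have 2: "(l / (3 * r)) ^ (DIM('a) - 1) / 8 ^ DIM('a) = l powr (n - 1) / (3 powr (n - 1) * r powr (n - 1)) / 8 ^ DIM('a)"
    using assms pw[of "l / (3 * r)"] by (simp add: powr_divide powr_mult)
  have 3: "3 powr (2 * n + 2 * s - 1) = 3 powr (n + 2 * s) * 3 powr (n - 1)"
    by (simp add: powr_add[symmetric] algebra_simps)
  have 4: "l powr (n + 2 * s) = l powr (2 * s + 1) * l powr (n - 1)"
    by (simp add: powr_add[symmetric] add.commute)
  show ?thesis unfolding 1 2 unfolding 3 n_def[symmetric] powr_mult 4 using assms by simp
qed

text \<open>A first-order version of the quadratic shell estimate. The lower bound for the volume of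
  the shell turns the right-hand side of \<open>osc_bound_identity\<close> into the square of
  \<open>E * W\<close>.\<close>

lemma shell_mean_osc_le:
  fixes u :: "'a::euclidean_space \<Rightarrow> real"
  assumes u [measurable]: "u \<in> borel_measurable borel" and rad: "radial u"
    and rl: "0 < r" "0 < l" "l \<le> 3 * r" and s: "0 < s"
    and M: "0 < M" "gagliardo_int s u \<le> ennreal (M\<^sup>2)"
  shows "(\<integral>\<^sup>+ x. (\<integral>\<^sup>+ y. ennreal \<bar>u x - u y\<bar> * indicator (shell r l) y \<partial>lborel) * indicator (shell r l) x \<partial>lborel)
     \<le> ennreal (M * osc_bound TYPE('a) s r l * (measure lborel (shell r l :: 'a set))\<^sup>2)"
proof -
  define W where "W = measure lborel (shell r l :: 'a set)"
  have W: "emeasure lborel (shell r l :: 'a set) = ennreal W" "W \<ge> 0"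
    unfolding W_def by (rule emeasure_shell(1)) (use rl in auto)
  have Wlow: "unit_ball_vol DIM('a) * r ^ (DIM('a) - 1) * l \<le> W"
    unfolding W_def by (rule measure_shell_bounds(1)) (use rl in auto)
  define E where "E = M * osc_bound TYPE('a) s r l"
  have E: "E > 0" using M osc_bound_pos[OF rl(1,2), of s, where 'a='a] by (auto simp: E_def)
  define t where "t = (l / (3 * r)) ^ (DIM('a) - 1) / 8 ^ DIM('a)"
  have t: "t > 0" using rl by (simp add: t_def)
  let ?S = "shell r l :: 'a set"
  define D where "D = (\<integral>\<^sup>+ x. \<integral>\<^sup>+ y. ennreal ((u x - u y)^2) * indicator ?S y * indicator ?S x \<partial>lborel \<partial>lborel)"
  have "ennreal t * D \<le> ennreal ((3 * l) powr (real DIM('a) + 2 * s)) * gagliardo_int s u"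
    unfolding D_def t_def by (rule shell_double_integral_le) (use assms in auto)
  also have "\<dots> \<le> ennreal ((3 * l) powr (real DIM('a) + 2 * s)) * ennreal (M\<^sup>2)"
    by (intro mult_left_mono M) auto
  also have "\<dots> = ennreal ((osc_bound TYPE('a) s r l * (unit_ball_vol DIM('a) * r ^ (DIM('a) - 1) * l))\<^sup>2 * t * M\<^sup>2)"
    using osc_bound_identity[OF rl(1,2), of s, where 'a='a] by (simp add: t_def ennreal_mult''[symmetric])
  also have "\<dots> = ennreal t * ennreal ((E * (unit_ball_vol DIM('a) * r ^ (DIM('a) - 1) * l))\<^sup>2)"
    using t by (simp add: E_def ennreal_mult'[symmetric] power_mult_distrib mult_ac)
  finally have "D \<le> ennreal ((E * (unit_ball_vol DIM('a) * r ^ (DIM('a) - 1) * l))\<^sup>2)"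
    using t by (simp add: ennreal_mult_le_mult_iff)
  also have "\<dots> \<le> ennreal ((E * W)\<^sup>2)"
    using E Wlow rl by (intro ennreal_leI power_mono mult_left_mono) auto
  finally have D: "D \<le> ennreal ((E * W)\<^sup>2)" .
  \<comment> \<open>Young's inequality replaces Cauchy-Schwarz. With the target value
    \<open>E\<close> as weight, the constant part and the quadratic part each contribute half of
    \<open>E * W\<^sup>2\<close>.\<close>
  have pw: "ennreal \<bar>a\<bar> \<le> ennreal (E / 2) + ennreal (1 / (2 * E)) * ennreal (a\<^sup>2)" for a
  proof -
    have "0 \<le> (\<bar>a\<bar> - E)\<^sup>2" by simp
    then have "2 * E * \<bar>a\<bar> \<le> E * E + a\<^sup>2" by (simp add: power2_diff power2_eq_square algebra_simps)
    then have "\<bar>a\<bar> \<le> E / 2 + 1 / (2 * E) * a\<^sup>2" using E by (simp add: field_simps power2_eq_square)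
    then show ?thesis using E by (simp add: ennreal_plus[symmetric] ennreal_mult''[symmetric] ennreal_leI del: ennreal_plus)
  qed
  have "(\<integral>\<^sup>+ x. (\<integral>\<^sup>+ y. ennreal \<bar>u x - u y\<bar> * indicator ?S y \<partial>lborel) * indicator ?S x \<partial>lborel)
      = (\<integral>\<^sup>+ x. \<integral>\<^sup>+ y. ennreal \<bar>u x - u y\<bar> * indicator ?S y * indicator ?S x \<partial>lborel \<partial>lborel)"
    by (simp add: nn_integral_multc)
  also have "\<dots> \<le> (\<integral>\<^sup>+ x. \<integral>\<^sup>+ y. ennreal (E / 2) * indicator ?S y * indicator ?S x + ennreal (1 / (2 * E)) * (ennreal ((u x - u y)^2) * indicator ?S y * indicator ?S x) \<partial>lborel \<partial>lborel)"
    by (intro nn_integral_mono) (use pw in \<open>auto simp: indicator_def\<close>)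
  also have "\<dots> = ennreal (E / 2) * (ennreal W * ennreal W) + ennreal (1 / (2 * E)) * D"
    by (simp add: nn_integral_add nn_integral_multc nn_integral_cmult D_def W mult.assoc)
  also have "\<dots> \<le> ennreal (E / 2) * (ennreal W * ennreal W) + ennreal (1 / (2 * E)) * ennreal ((E * W)\<^sup>2)"
    by (intro add_left_mono mult_left_mono D) auto
  also have "\<dots> = ennreal (E * W\<^sup>2)"
    using E W(2) by (simp add: ennreal_plus[symmetric] ennreal_mult''[symmetric] power2_eq_square field_simps del: ennreal_plus)
  finally show ?thesis by (simp add: E_def W_def)
qed

text \<open>If every constant failed, so would \<open>c = u x\<close> for each \<open>x\<close>, and
  integrating over \<open>x\<close> would contradict the bound on the double integral. The factor 2
  leaves room for the contradiction; arguing this way avoids forming a mean of \<open>u\<close>,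
  whose integrability is not known beforehand.\<close>

lemma shell_center_exists:
  fixes u :: "'a::euclidean_space \<Rightarrow> real"
  assumes u [measurable]: "u \<in> borel_measurable borel" and rad: "radial u"
    and rl: "0 < r" "0 < l" "l \<le> 3 * r" and s: "0 < s"
    and M: "0 < M" "gagliardo_int s u \<le> ennreal (M\<^sup>2)"
  shows "\<exists>c. (\<integral>\<^sup>+ x. ennreal \<bar>u x - c\<bar> * indicator (shell r l) x \<partial>lborel)
     \<le> ennreal (2 * M * osc_bound TYPE('a) s r l * measure lborel (shell r l :: 'a set))"
proof (rule ccontr)
  define W where "W = measure lborel (shell r l :: 'a set)"
  define E where "E = M * osc_bound TYPE('a) s r l"
  have E: "E > 0" using M osc_bound_pos[OF rl(1,2), of s, where 'a='a] by (auto simp: E_def)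
  have "0 < unit_ball_vol DIM('a) * r ^ (DIM('a) - 1) * l" using rl by simp
  also have "\<dots> \<le> W" unfolding W_def by (rule measure_shell_bounds(1)) (use rl in auto)
  finally have W: "W > 0" .
  let ?S = "shell r l :: 'a set"
  assume "\<not> ?thesis"
  then have c: "ennreal (2 * E * W) \<le> (\<integral>\<^sup>+ y. ennreal \<bar>u y - c\<bar> * indicator ?S y \<partial>lborel)" for c
    by (simp add: not_le E_def W_def mult.assoc less_imp_le)
  have "ennreal (2 * E * W) * ennreal W = (\<integral>\<^sup>+ x. ennreal (2 * E * W) * indicator ?S x \<partial>lborel)"
    using emeasure_shell(1)[OF rl(1,2), where 'a='a] by (simp add: nn_integral_cmult_indicator W_def)
  also have "\<dots> \<le> (\<integral>\<^sup>+ x. (\<integral>\<^sup>+ y. ennreal \<bar>u x - u y\<bar> * indicator ?S y \<partial>lborel) * indicator ?S x \<partial>lborel)"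
    by (intro nn_integral_mono mult_right_mono) (use c in \<open>auto simp: abs_minus_commute\<close>)
  also have "\<dots> \<le> ennreal (E * W\<^sup>2)"
    using shell_mean_osc_le[OF assms] by (simp add: E_def W_def)
  finally have "ennreal (2 * E * W * W) \<le> ennreal (E * W\<^sup>2)" using E W by (simp add: ennreal_mult''[symmetric])
  then have "2 * E * W * W \<le> E * W\<^sup>2" using E W by (subst (asm) ennreal_le_iff) auto
  then show False using E W by (simp add: power2_eq_square)
qed

section \<open>Comparison of oscillation bounds and the Campanato iteration\<close>

lemma osc_bound_mono_radius:
  assumes "0 < r" "r \<le> r'"
  shows "osc_bound TYPE('a::euclidean_space) s r' l \<le> osc_bound TYPE('a) s r l"
proof -
  have "(1 - real DIM('a)) / 2 \<le> 0" using DIM_positive[where 'a='a] by (simp add: Suc_leI)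
  then have "r' powr ((1 - real DIM('a)) / 2) \<le> r powr ((1 - real DIM('a)) / 2)"
    using assms by (intro powr_mono2') auto
  then show ?thesis unfolding osc_bound_def by (intro mult_left_mono mult_right_mono) auto
qed

lemma osc_bound_mono_width:
  assumes "0 < l'" "l' \<le> l" "1/2 < s"
  shows "osc_bound TYPE('a::euclidean_space) s r l' \<le> osc_bound TYPE('a) s r l"
  unfolding osc_bound_def using assms by (intro mult_left_mono powr_mono2) auto

text \<open>The factor \<open>2 powr (1/2 - s)\<close> is the ratio of the geometric series in the
  iteration; it is below 1 precisely when s > 1/2.\<close>

lemma osc_bound_half:
  assumes "0 < l"
  shows "osc_bound TYPE('a::euclidean_space) s r (l / 2) = osc_bound TYPE('a) s r l * 2 powr (1/2 - s)"
proof -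
  have "(l / 2) powr (s - 1/2) = l powr (s - 1/2) * 2 powr (1/2 - s)"
    using assms by (simp add: powr_divide powr_minus_divide[symmetric] divide_powr_uminus)
  then show ?thesis by (simp add: osc_bound_def)
qed

text \<open>Serves to compare the centres of two nested shells: both constants are close to the same
  function in mean on the smaller shell, and the triangle inequality is integrated there.\<close>

lemma le_if_nn_integral_bounds:
  assumes "0 < w" and J: "emeasure M J = ennreal w" "J \<in> sets M"
    and [measurable]: "f \<in> borel_measurable M"
    and "(\<integral>\<^sup>+ x. ennreal \<bar>f x - a\<bar> * indicator J x \<partial>M) \<le> ennreal A"
    and "(\<integral>\<^sup>+ x. ennreal \<bar>f x - b\<bar> * indicator J x \<partial>M) \<le> ennreal B"
    and "0 \<le> A" "0 \<le> B"
  shows "\<bar>a - b\<bar> * w \<le> A + B"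
proof -
  note [measurable] = J(2)
  have "ennreal \<bar>a - b\<bar> * ennreal w = (\<integral>\<^sup>+ x. ennreal \<bar>a - b\<bar> * indicator J x \<partial>M)"
    by (simp add: nn_integral_cmult_indicator J)
  also have "\<dots> \<le> (\<integral>\<^sup>+ x. ennreal \<bar>f x - a\<bar> * indicator J x + ennreal \<bar>f x - b\<bar> * indicator J x \<partial>M)"
    by (intro nn_integral_mono) (auto simp: indicator_def ennreal_plus[symmetric] intro!: ennreal_leI simp del: ennreal_plus)
  also have "\<dots> \<le> ennreal A + ennreal B"
    using assms by (subst nn_integral_add) (auto intro!: add_mono)
  finally have "ennreal (\<bar>a - b\<bar> * w) \<le> ennreal (A + B)"
    using assms by (simp add: ennreal_mult'')
  then show ?thesis using assms by (subst (asm) ennreal_le_iff) auto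
qed

text \<open>Sum of the series of centre shifts. One halving moves the centre by at most
  \<open>2 * (rho + 1)\<close> times the current bound, where
  \<open>rho = 2 * real DIM('a) * 4 ^ (DIM('a) - 1)\<close> bounds the volume ratio of a shell to
  either of its halves; the denominator is the geometric sum.\<close>

definition chain_const :: "'a::euclidean_space itself \<Rightarrow> real \<Rightarrow> real" where
  "chain_const T s = 2 * (2 * real DIM('a) * 4 ^ (DIM('a) - 1) + 1) / (1 - 2 powr (1/2 - s))"

lemma chain_const:
  assumes "1/2 < s"
  shows "0 < chain_const TYPE('a::euclidean_space) s"
    and "chain_const TYPE('a) s = 2 * (2 * real DIM('a) * 4 ^ (DIM('a) - 1) + 1) + chain_const TYPE('a) s * 2 powr (1/2 - s)"
proof -
  have "2 powr (1/2 - s) < (1::real)" using assms powr_less_mono[of "1/2 - s" 0 2] by simp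
  then have t: "0 < 1 - (2::real) powr (1/2 - s)" by simp
  show "0 < chain_const TYPE('a) s"
    unfolding chain_const_def using t by (intro divide_pos_pos mult_pos_pos add_nonneg_pos) auto
  have "chain_const TYPE('a) s * (1 - 2 powr (1/2 - s)) = 2 * (2 * real DIM('a) * 4 ^ (DIM('a) - 1) + 1)"
    unfolding chain_const_def using less_imp_neq[OF t, THEN not_sym]
    by (simp only: times_divide_eq_left nonzero_mult_div_cancel_right not_False_eq_True)
  then show "chain_const TYPE('a) s = 2 * (2 * real DIM('a) * 4 ^ (DIM('a) - 1) + 1) + chain_const TYPE('a) s * 2 powr (1/2 - s)"
    by (simp only: right_diff_distrib)
qed

text \<open>Campanato's argument: the centres of nested shells, each half as thick as the preceding one,
  differ by the terms of a convergent geometric series because \<open>s > 1/2\<close>.\<close>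

lemma shell_AE_osc:
  fixes u :: "'a::euclidean_space \<Rightarrow> real"
  assumes u [measurable]: "u \<in> borel_measurable borel" and rad: "radial u"
    and rl: "0 < r" "0 < l" "l \<le> 3 * r" and s: "1/2 < s"
    and M: "0 < M" "gagliardo_int s u \<le> ennreal (M\<^sup>2)"
  shows "\<exists>c. AE x in lborel. x \<in> shell r l \<longrightarrow> \<bar>u x - c\<bar> \<le> chain_const TYPE('a) s * M * osc_bound TYPE('a) s r l"
proof -
  let ?W = "\<lambda>r l. measure lborel (shell r l :: 'a set)"
  let ?E = "\<lambda>l. M * osc_bound TYPE('a) s r l"
  let ?C = "chain_const TYPE('a) s"
  let ?rho = "2 * real DIM('a) * 4 ^ (DIM('a) - 1)"
  define t where "t = 2 powr (1/2 - s)"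
  have t: "0 < t" "t < 1" unfolding t_def using s powr_less_mono[of "1/2 - s" 0 2] by auto
  have s0: "0 < s" using s by simp
  define c where "c r' l' = (SOME c. (\<integral>\<^sup>+ x. ennreal \<bar>u x - c\<bar> * indicator (shell r' l') x \<partial>lborel)
     \<le> ennreal (2 * M * osc_bound TYPE('a) s r' l' * ?W r' l'))" for r' l'
  have c0: "(\<integral>\<^sup>+ x. ennreal \<bar>u x - c r' l'\<bar> * indicator (shell r' l') x \<partial>lborel)
     \<le> ennreal (2 * M * osc_bound TYPE('a) s r' l' * ?W r' l')" if "r \<le> r'" "0 < l'" "l' \<le> 3 * r'" for r' l'
    unfolding c_def
    by (rule someI_ex, rule shell_center_exists[OF u rad _ _ _ s0 M]) (use that rl in auto)
  \<comment> \<open>The bound is frozen at the inner radius \<open>r\<close> of the original shell,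
    which is the worst one, so that from here on only the thickness matters.\<close>
  have c: "(\<integral>\<^sup>+ x. ennreal \<bar>u x - c r' l'\<bar> * indicator (shell r' l') x \<partial>lborel) \<le> ennreal (2 * ?E l' * ?W r' l')"
    if "r \<le> r'" "0 < l'" "l' \<le> 3 * r'" for r' l'
  proof -
    have "2 * M * osc_bound TYPE('a) s r' l' * ?W r' l' \<le> 2 * ?E l' * ?W r' l'"
      using M osc_bound_mono_radius[OF rl(1) that(1), of s l', where 'a='a]
      by (intro mult_right_mono) auto
    then show ?thesis using c0[OF that] ennreal_leI order_trans by blast
  qed
  have E: "?E l' > 0" if "0 < l'" for l' using M osc_bound_pos[OF rl(1) that, of s, where 'a='a] by simp
  have half: "\<bar>c r' l' - c r'' (l' / 2)\<bar> \<le> 2 * (?rho + 1) * ?E l'"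
    if a: "r \<le> r'" "0 < l'" "l' \<le> 3 * r'" and r'': "r'' = r' \<or> r'' = r' + l' / 2" for r' r'' l'
  proof -
    define w where "w = ?W r'' (l' / 2)"
    have b: "r \<le> r''" "0 < l' / 2" "l' / 2 \<le> 3 * r''" "r' \<le> r''" "0 < r'" using a r'' rl by auto
    have sub: "(shell r'' (l' / 2) :: 'a set) \<subseteq> shell r' l'" using r'' a by (auto simp: shell_def)
    have "unit_ball_vol DIM('a) * r' ^ (DIM('a) - 1) * (l' / 2) \<le> unit_ball_vol DIM('a) * r'' ^ (DIM('a) - 1) * (l' / 2)"
      using b by (intro mult_left_mono mult_right_mono power_mono) auto
    also have "\<dots> \<le> w" unfolding w_def by (rule measure_shell_bounds(1)) (use b in auto)
    finally have w1: "unit_ball_vol DIM('a) * r' ^ (DIM('a) - 1) * (l' / 2) \<le> w" .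
    moreover have "0 < unit_ball_vol DIM('a) * r' ^ (DIM('a) - 1) * (l' / 2)" using b by simp
    ultimately have w: "w > 0" by linarith
    have "?W r' l' \<le> unit_ball_vol DIM('a) * (real DIM('a) * (4 * r') ^ (DIM('a) - 1) * l')"
      by (rule measure_shell_bounds(2)) (use a b in auto)
    also have "\<dots> = ?rho * (unit_ball_vol DIM('a) * r' ^ (DIM('a) - 1) * (l' / 2))"
      by (simp add: power_mult_distrib)
    also have "\<dots> \<le> ?rho * w" by (intro mult_left_mono w1) auto
    finally have Ww: "?W r' l' \<le> ?rho * w" .
    have 1: "(\<integral>\<^sup>+ x. ennreal \<bar>u x - c r' l'\<bar> * indicator (shell r'' (l' / 2)) x \<partial>lborel) \<le> ennreal (2 * ?E l' * (?rho * w))"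
    proof -
      have "(\<integral>\<^sup>+ x. ennreal \<bar>u x - c r' l'\<bar> * indicator (shell r'' (l' / 2)) x \<partial>lborel)
          \<le> (\<integral>\<^sup>+ x. ennreal \<bar>u x - c r' l'\<bar> * indicator (shell r' l') x \<partial>lborel)"
        using sub by (intro nn_integral_mono) (auto simp: indicator_def)
      also have "\<dots> \<le> ennreal (2 * ?E l' * ?W r' l')" by (rule c[OF a])
      also have "\<dots> \<le> ennreal (2 * ?E l' * (?rho * w))"
        using E[OF a(2)] by (intro ennreal_leI mult_left_mono Ww) auto
      finally show ?thesis .
    qed
    have 2: "(\<integral>\<^sup>+ x. ennreal \<bar>u x - c r'' (l' / 2)\<bar> * indicator (shell r'' (l' / 2)) x \<partial>lborel) \<le> ennreal (2 * ?E l' * w)"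
    proof -
      have "2 * ?E (l' / 2) * w \<le> 2 * ?E l' * w"
        using M w a osc_bound_mono_width[of "l' / 2" l' s r, where 'a='a] s by (intro mult_right_mono mult_left_mono) auto
      then show ?thesis using c[OF b(1-3)] unfolding w_def by (meson ennreal_leI order_trans)
    qed
    have "\<bar>c r' l' - c r'' (l' / 2)\<bar> * w \<le> 2 * ?E l' * (?rho * w) + 2 * ?E l' * w"
    proof (rule le_if_nn_integral_bounds[OF w _ _ _ 1 2])
      show "emeasure lborel (shell r'' (l' / 2) :: 'a set) = ennreal w"
        unfolding w_def by (rule emeasure_shell(1)) (use b in auto)
      show "0 \<le> 2 * ?E l' * (?rho * w)" "0 \<le> 2 * ?E l' * w"
        using M(1) w less_imp_le[OF osc_bound_pos[OF rl(1) a(2), of s, where 'a='a]] by auto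
    qed auto
    also have "\<dots> = 2 * (?rho + 1) * ?E l' * w" by (simp add: algebra_simps)
    finally show ?thesis using w by simp
  qed
  \<comment> \<open>This replaces Lebesgue differentiation. \<open>ennreal\<close> cuts negative
    values off, so the integrand is the excess over the claimed bound; \<open>k\<close> halvings
    show that its integral is of size \<open>t ^ k\<close>, hence zero.\<close>
  have chain: "(\<integral>\<^sup>+ x. ennreal (\<bar>u x - c r' l'\<bar> - ?C * ?E l') * indicator (shell r' l') x \<partial>lborel)
     \<le> ennreal (2 * ?E l' * t ^ k * ?W r' l')" if a: "r \<le> r'" "0 < l'" "l' \<le> 3 * r'" for k r' l'
    using that
  proof (induction k arbitrary: r' l')
    case 0
    have "(\<integral>\<^sup>+ x. ennreal (\<bar>u x - c r' l'\<bar> - ?C * ?E l') * indicator (shell r' l') x \<partial>lborel)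
      \<le> (\<integral>\<^sup>+ x. ennreal \<bar>u x - c r' l'\<bar> * indicator (shell r' l') x \<partial>lborel)"
      using E[OF 0(2)] chain_const(1)[OF s, where 'a='a]
      by (intro nn_integral_mono mult_right_mono ennreal_leI) (auto simp: less_imp_le)
    also have "\<dots> \<le> ennreal (2 * ?E l' * t ^ 0 * ?W r' l')" using c[OF 0] by simp
    finally show ?case .
  next
    case (Suc k)
    let ?l = "l' / 2"
    let ?J1 = "shell r' ?l :: 'a set" and ?J2 = "shell (r' + ?l) ?l :: 'a set"
    have Eh: "?E ?l = ?E l' * t" using osc_bound_half[OF Suc.prems(2), of s r, where 'a='a] by (simp add: t_def)
    \<comment> \<open>The recursion of \<open>chain_const\<close>: passing to a half shell shrinks
      the allowance by exactly the largest possible shift of the centre, so the excess cannot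
      decrease.\<close>
    have eq: "?C * ?E l' = 2 * (?rho + 1) * ?E l' + ?C * ?E ?l"
      unfolding Eh using arg_cong[OF chain_const(2)[OF s, where 'a='a], of "\<lambda>c. c * ?E l'"]
      unfolding t_def[symmetric] by (simp only: distrib_right distrib_left mult_ac)
    have p: "ennreal (\<bar>u x - c r' l'\<bar> - ?C * ?E l') \<le> ennreal (\<bar>u x - c r'' ?l\<bar> - ?C * ?E ?l)"
      if "r'' = r' \<or> r'' = r' + l' / 2" for x r''
      using half[OF Suc.prems that] eq by (intro ennreal_leI) linarith
    have W: "?W r' l' = ?W r' ?l + ?W (r' + ?l) ?l"
    proof -
      have "0 < r'" "0 < l'" using Suc.prems rl by auto
      then show ?thesis by (simp add: emeasure_shell(2) algebra_simps)
    qed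
    have "(\<integral>\<^sup>+ x. ennreal (\<bar>u x - c r' l'\<bar> - ?C * ?E l') * indicator (shell r' l') x \<partial>lborel)
      \<le> (\<integral>\<^sup>+ x. ennreal (\<bar>u x - c r' ?l\<bar> - ?C * ?E ?l) * indicator ?J1 x
            + ennreal (\<bar>u x - c (r' + ?l) ?l\<bar> - ?C * ?E ?l) * indicator ?J2 x \<partial>lborel)"
      using p[of r'] p[of "r' + ?l"] by (intro nn_integral_mono) (auto simp: indicator_def shell_def)
    also have "\<dots> = (\<integral>\<^sup>+ x. ennreal (\<bar>u x - c r' ?l\<bar> - ?C * ?E ?l) * indicator ?J1 x \<partial>lborel)
        + (\<integral>\<^sup>+ x. ennreal (\<bar>u x - c (r' + ?l) ?l\<bar> - ?C * ?E ?l) * indicator ?J2 x \<partial>lborel)"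
      by (rule nn_integral_add) measurable
    also have "\<dots> \<le> ennreal (2 * ?E ?l * t ^ k * ?W r' ?l) + ennreal (2 * ?E ?l * t ^ k * ?W (r' + ?l) ?l)"
      using Suc.prems rl by (intro add_mono Suc.IH) auto
    also have "\<dots> = ennreal (2 * ?E ?l * t ^ k * ?W r' ?l + 2 * ?E ?l * t ^ k * ?W (r' + ?l) ?l)"
      using E[of ?l] Suc.prems t by (intro ennreal_plus[symmetric]) auto
    also have "2 * ?E ?l * t ^ k * ?W r' ?l + 2 * ?E ?l * t ^ k * ?W (r' + ?l) ?l = 2 * ?E l' * t ^ Suc k * ?W r' l'"
      unfolding Eh W by (simp add: algebra_simps)
    finally show ?case .
  qed
  let ?I = "\<integral>\<^sup>+ x. ennreal (\<bar>u x - c r l\<bar> - ?C * ?E l) * indicator (shell r l) x \<partial>lborel"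
  have "(\<lambda>k. ennreal (2 * ?E l * t ^ k * ?W r l)) \<longlonglongrightarrow> ennreal (2 * ?E l * 0 * ?W r l)"
    using t by (intro tendsto_intros LIMSEQ_power_zero) auto
  then have "?I \<le> ennreal (2 * ?E l * 0 * ?W r l)"
    by (rule LIMSEQ_le_const) (use chain[OF order_refl rl(2,3)] in auto)
  then have "?I = 0" by simp
  then have "AE x in lborel. ennreal (\<bar>u x - c r l\<bar> - ?C * ?E l) * indicator (shell r l) x = 0"
    by (subst (asm) nn_integral_0_iff_AE) measurable
  then have "AE x in lborel. x \<in> shell r l \<longrightarrow> \<bar>u x - c r l\<bar> \<le> ?C * M * osc_bound TYPE('a) s r l"
    by (rule AE_mp) (auto simp: indicator_def ennreal_eq_0_iff mult.assoc)
  then show ?thesis by blast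
qed

section \<open>Decay at infinity\<close>

lemma AE_imp_exists_on:
  assumes "AE x in M. x \<in> A \<longrightarrow> P x" "A \<in> sets M" "0 < emeasure M A"
  shows "\<exists>x\<in>A. P x"
proof (rule ccontr)
  assume "\<not> ?thesis"
  then have "AE x in M. x \<notin> A" using assms(1) by (auto elim: AE_mp)
  then have "A \<in> null_sets M" using assms(2) by (subst AE_iff_null_sets) auto
  then show False using assms(3) by auto
qed

lemma shell_pos:
  assumes "0 < r" "0 < l"
  shows "0 < emeasure lborel (shell r l :: 'a::euclidean_space set)"
proof -
  have "r ^ DIM('a) < (r + l) ^ DIM('a)" using assms by (intro power_strict_mono) auto
  then show ?thesis
    unfolding emeasure_shell[OF assms, where 'a='a] by simp
qed

text \<open>Minimality of \<open>j\<close> gives the lower bound on the norm. The ratio 4 of outer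
  to inner radius is the widest that \<open>shell_AE_osc\<close> admits, and it makes consecutive
  shells overlap.\<close>

lemma shell_chain_cover:
  assumes "0 < a" "a < norm x"
  shows "\<exists>j. x \<in> shell (2 ^ j * a) (3 * (2 ^ j * a))"
proof -
  define j where "j = (LEAST j. norm x \<le> 2 ^ j * (4 * a))"
  obtain n where "norm x / (4 * a) < 2 ^ n" using real_arch_pow[of 2 "norm x / (4 * a)"] by auto
  then have "norm x \<le> 2 ^ n * (4 * a)" using assms by (simp add: field_simps)
  then have j: "norm x \<le> 2 ^ j * (4 * a)" unfolding j_def by (rule LeastI)
  have "2 ^ j * a < norm x"
  proof (cases j)
    case (Suc i)
    then have "\<not> norm x \<le> 2 ^ i * (4 * a)" unfolding j_def by (metis lessI not_less_Least)
    then show ?thesis using Suc assms by (simp add: not_le)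
  qed (use assms in simp)
  moreover have "norm x \<le> 2 ^ j * a + 3 * (2 ^ j * a)" using j by (simp add: mult_ac)
  ultimately show ?thesis unfolding shell_def by blast
qed

text \<open>The exponents of radius and thickness add up to s - N/2, which is negative for 2s < N;
  this is the source of decay along dyadic shells.\<close>

lemma osc_bound_scale:
  assumes "0 < r" "0 < l" "0 < k"
  shows "osc_bound TYPE('a::euclidean_space) s (k * r) (k * l) = k powr (s - real DIM('a) / 2) * osc_bound TYPE('a) s r l"
proof -
  have "(k * r) powr ((1 - real DIM('a)) / 2) * (k * l) powr (s - 1/2)
     = k powr ((1 - real DIM('a)) / 2) * k powr (s - 1/2) * (r powr ((1 - real DIM('a)) / 2) * l powr (s - 1/2))"
    using assms by (simp add: powr_mult)
  also have "k powr ((1 - real DIM('a)) / 2) * k powr (s - 1/2) = k powr (s - real DIM('a) / 2)"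
    unfolding powr_add[symmetric] by (rule arg_cong[where f = "\<lambda>e. k powr e"]) (simp add: diff_divide_distrib)
  finally show ?thesis by (simp add: osc_bound_def)
qed

text \<open>The oscillation over \<open>2 ^ k * a < norm x \<le> 4 * 2 ^ k * a\<close> decays geometrically in \<open>k\<close> because
  \<open>2 * s < DIM('a)\<close>, so \<open>u\<close> has a limit at infinity; integrability of a power of \<open>u\<close> makes this limit zero.\<close>

lemma radial_AE_bound:
  assumes N: "DIM('a::euclidean_space) \<ge> 2" and s: "1/2 < s" "s < 1" and a: "0 < a"
  shows "\<exists>C>0. \<forall>(u::'a \<Rightarrow> real) M p. u \<in> borel_measurable borel \<longrightarrow> radial u \<longrightarrow> 0 < p \<longrightarrow>
     (\<integral>\<^sup>+ x. ennreal (\<bar>u x\<bar> powr p) \<partial>lborel) < \<infinity> \<longrightarrow> 0 < M \<longrightarrow> gagliardo_int s u \<le> ennreal (M\<^sup>2) \<longrightarrow>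
     (AE x in lborel. a < norm x \<longrightarrow> \<bar>u x\<bar> \<le> C * M)"
proof -
  define E where "E k = chain_const TYPE('a) s * osc_bound TYPE('a) s (2 ^ k * a) (3 * (2 ^ k * a))" for k :: nat
  define q where "q = 2 powr (s - real DIM('a) / 2)"
  have q: "0 < q" "q < 1"
    unfolding q_def using N s powr_less_mono[of "s - real DIM('a) / 2" 0 2] by auto
  define e where "e = E 0"
  have e0: "e > 0" unfolding e_def E_def using a chain_const(1)[OF s(1), where 'a='a]
    by (intro mult_pos_pos osc_bound_pos) auto
  have Ek: "E k = e * q ^ k" for k
  proof -
    have "osc_bound TYPE('a) s (2 ^ k * a) (3 * (2 ^ k * a)) = (2 ^ k) powr (s - real DIM('a) / 2) * osc_bound TYPE('a) s a (3 * a)"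
      using osc_bound_scale[of a "3 * a" "2 ^ k" s, where 'a='a] a by (simp add: mult_ac)
    also have "(2 ^ k) powr (s - real DIM('a) / 2) = q ^ k"
      by (simp add: q_def powr_realpow[symmetric] powr_powr mult.commute)
    finally show ?thesis by (simp add: E_def e_def)
  qed
  have Ekpos: "E k > 0" for k unfolding Ek using e0 q by simp
  \<comment> \<open>The 1 accounts for the oscillation around the centre, and
    \<open>2 / (1 - q)\<close> for the summed differences of consecutive centres.\<close>
  define C where "C = e * (1 + 2 / (1 - q))"
  have "0 < 2 / (1 - q)" using q(2) by simp
  then have C: "C > 0" unfolding C_def by (intro mult_pos_pos e0 add_pos_pos zero_less_one)
  have "AE x in lborel. a < norm x \<longrightarrow> \<bar>u x\<bar> \<le> C * M"
    if u [measurable]: "u \<in> borel_measurable borel" and rad: "radial u" and p: "0 < p"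
      and int: "(\<integral>\<^sup>+ x. ennreal (\<bar>u x\<bar> powr p) \<partial>lborel) < \<infinity>"
      and M: "0 < M" "gagliardo_int s u \<le> ennreal (M\<^sup>2)" for u :: "'a \<Rightarrow> real" and M p
  proof -
    let ?I = "\<lambda>k. shell (2 ^ k * a) (3 * (2 ^ k * a)) :: 'a set"
    define c where "c k = (SOME c. AE x in lborel. x \<in> ?I k \<longrightarrow> \<bar>u x - c\<bar> \<le> M * E k)" for k
    have c: "AE x in lborel. x \<in> ?I k \<longrightarrow> \<bar>u x - c k\<bar> \<le> M * E k" for k
      unfolding c_def
      by (rule someI_ex) (use shell_AE_osc[OF u rad _ _ _ s(1) M, of "2 ^ k * a" "3 * (2 ^ k * a)"] a in \<open>simp add: E_def mult_ac\<close>)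
    \<comment> \<open>Both centres are compared with \<open>u x\<close> at one good point
      \<open>x\<close> of the overlap \<open>?J\<close> of the two shells.\<close>
    have step: "\<bar>c k - c (Suc k)\<bar> \<le> 2 * M * E k" for k
    proof -
      let ?J = "shell (2 * (2 ^ k * a)) (2 * (2 ^ k * a)) :: 'a set"
      have A: "0 < 2 ^ k * a" using a by simp
      have J: "?J \<subseteq> ?I k" "?J \<subseteq> ?I (Suc k)"
        unfolding shell_def power_Suc mult.assoc using A by auto
      have "AE x in lborel. x \<in> ?J \<longrightarrow> \<bar>u x - c k\<bar> \<le> M * E k \<and> \<bar>u x - c (Suc k)\<bar> \<le> M * E (Suc k)"
        using c[of k] c[of "Suc k"] by eventually_elim (use J in blast)
      then obtain x where "\<bar>u x - c k\<bar> \<le> M * E k" "\<bar>u x - c (Suc k)\<bar> \<le> M * E (Suc k)"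
        using AE_imp_exists_on[OF _ _ shell_pos[of "2 * (2 ^ k * a)" "2 * (2 ^ k * a)"]] a by fastforce
      moreover have "M * E (Suc k) \<le> M * E k"
        using M q e0 by (auto simp: Ek intro!: mult_left_mono power_decreasing)
      ultimately show ?thesis by linarith
    qed
    have tele: "\<bar>c j - c (j + m)\<bar> \<le> 2 * M * E j / (1 - q)" for j m
    proof (induction m arbitrary: j)
      case 0
      then show ?case using M q Ekpos[of j] by simp
    next
      case (Suc m)
      have "\<bar>c j - c (j + Suc m)\<bar> \<le> 2 * M * E j + 2 * M * E (Suc j) / (1 - q)"
        using step[of j] Suc.IH[of "Suc j"] by simp
      also have "E (Suc j) = E j * q" by (simp add: Ek)
      also have "2 * M * E j + 2 * M * (E j * q) / (1 - q) = 2 * M * E j / (1 - q)"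
        using q by (simp add: field_simps)
      finally show ?case .
    qed
    \<comment> \<open>Otherwise \<open>u\<close> would be at least \<epsilon> in absolute value on
      far shells, whose volume is unbounded. In the choice of \<open>k\<close>, \<open>n1\<close>
      makes the volume beat the integral \<open>L\<close>, and \<open>n2\<close> brings the
      oscillation below \<epsilon>.\<close>
    have small: "\<exists>m. \<bar>c (j + m)\<bar> \<le> 2 * \<epsilon>" if \<epsilon>: "0 < \<epsilon>" for j \<epsilon>
    proof (rule ccontr)
      assume "\<not> ?thesis"
      then have big: "2 * \<epsilon> < \<bar>c (j + m)\<bar>" for m by (meson not_le)
      obtain L where L: "(\<integral>\<^sup>+ x. ennreal (\<bar>u x\<bar> powr p) \<partial>lborel) = ennreal L" "0 \<le> L"
        using int by (metis ennreal_cases infinity_ennreal_def less_irrefl)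
      define A where "A = \<epsilon> powr p * (unit_ball_vol DIM('a) * a ^ (DIM('a) - 1) * a)"
      have A: "A > 0" using a \<epsilon> by (simp add: A_def)
      obtain n1 where n1: "L / A < 2 ^ n1" using real_arch_pow[of 2 "L / A"] by auto
      obtain n2 where n2: "q ^ n2 < \<epsilon> / (M * e)"
        using real_arch_pow_inv[of "\<epsilon> / (M * e)" q] \<epsilon> M e0 q by auto
      define k where "k = j + (n1 + n2)"
      have "q ^ k \<le> q ^ n2" using q by (intro power_decreasing) (auto simp: k_def)
      then have "q ^ k < \<epsilon> / (M * e)" using n2 by simp
      then have MEk: "M * E k < \<epsilon>" using M e0 by (simp add: Ek field_simps)
      have "(2::real) ^ n1 \<le> 2 ^ k" by (intro power_increasing) (auto simp: k_def)
      then have "L / A < 2 ^ k" using n1 by linarith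
      then have LA: "L < A * 2 ^ k" using A by (simp add: field_simps)
      have ck: "2 * \<epsilon> < \<bar>c k\<bar>" using big[of "n1 + n2"] by (simp add: k_def)
      have "A * 2 ^ k \<le> \<epsilon> powr p * measure lborel (?I k)"
      proof -
        have "unit_ball_vol DIM('a) * a ^ (DIM('a) - 1) * a * 2 ^ k
            \<le> unit_ball_vol DIM('a) * (2 ^ k * a) ^ (DIM('a) - 1) * (3 * (2 ^ k * a))"
        proof -
          have "a \<le> 2 ^ k * a" using a by simp
          then have "a ^ (DIM('a) - 1) * (a * 2 ^ k) \<le> (2 ^ k * a) ^ (DIM('a) - 1) * (3 * (2 ^ k * a))"
            by (rule mult_mono[OF power_mono]) (use a in auto)
          then show ?thesis unfolding mult.assoc by (intro mult_left_mono) auto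
        qed
        also have "\<dots> \<le> measure lborel (?I k)"
          by (rule measure_shell_bounds(1)) (use a in auto)
        finally show ?thesis unfolding A_def mult.assoc by (intro mult_left_mono) auto
      qed
      then have "ennreal (A * 2 ^ k) \<le> ennreal (\<epsilon> powr p) * emeasure lborel (?I k)"
        using a by (subst emeasure_shell(1)) (auto simp: ennreal_mult''[symmetric] ennreal_leI)
      also have "\<dots> = (\<integral>\<^sup>+ x. ennreal (\<epsilon> powr p) * indicator (?I k) x \<partial>lborel)"
        by (simp add: nn_integral_cmult_indicator)
      also have "\<dots> \<le> (\<integral>\<^sup>+ x. ennreal (\<bar>u x\<bar> powr p) \<partial>lborel)"
      proof (rule nn_integral_mono_AE)
        show "AE x in lborel. ennreal (\<epsilon> powr p) * indicator (?I k) x \<le> ennreal (\<bar>u x\<bar> powr p)"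
          using c[of k]
        proof eventually_elim
          case (elim x)
          show ?case
          proof (cases "x \<in> ?I k")
            case True
            then have "\<epsilon> \<le> \<bar>u x\<bar>" using elim MEk ck by linarith
            then show ?thesis using \<epsilon> p by (auto simp: indicator_def intro!: ennreal_leI powr_mono2)
          qed simp
        qed
      qed
      finally show False using L LA A by (simp add: ennreal_le_iff)
    qed
    have cj: "\<bar>c j\<bar> \<le> 2 * M * E j / (1 - q)" for j
    proof (rule field_le_epsilon)
      fix d :: real assume "0 < d"
      then obtain m where "\<bar>c (j + m)\<bar> \<le> d" using small[of "d / 2" j] by auto
      then show "\<bar>c j\<bar> \<le> 2 * M * E j / (1 - q) + d" using tele[of j m] by linarith
    qed
    have "AE x in lborel. \<forall>j. x \<in> ?I j \<longrightarrow> \<bar>u x - c j\<bar> \<le> M * E j"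
      using c by (subst AE_all_countable) auto
    then show ?thesis
    proof eventually_elim
      case (elim x)
      show ?case
      proof
        assume "a < norm x"
        then obtain j where "x \<in> ?I j" using shell_chain_cover[OF a] by blast
        then have "\<bar>u x - c j\<bar> \<le> M * E j" using elim by blast
        then have "\<bar>u x\<bar> \<le> M * E j + 2 * M * E j / (1 - q)" using cj[of j] by linarith
        also have "\<dots> = E j * ((1 + 2 / (1 - q)) * M)" using q by (simp add: field_simps)
        also have "\<dots> \<le> e * ((1 + 2 / (1 - q)) * M)"
          using M q e0 by (intro mult_right_mono) (auto simp: Ek power_le_one mult_le_cancel_left1)
        finally show "\<bar>u x\<bar> \<le> C * M" by (simp add: C_def mult_ac)
      qed
    qed
  qed
  with C show ?thesis by blast
qed

section \<open>The normalising constant\<close>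

text \<open>Replaces integration in polar coordinates: the integrand is dominated by a countable sum
  of constants times indicators of balls, whose integrals form the given series up to the volume of
  the unit ball.\<close>

lemma nn_integral_finite_by_balls:
  fixes f :: "'a::euclidean_space \<Rightarrow> ennreal" and R A :: "nat \<Rightarrow> real"
  assumes cover: "\<And>z. f z \<noteq> 0 \<Longrightarrow> \<exists>k. norm z \<le> R k \<and> f z \<le> ennreal (A k)"
    and nonneg: "\<And>k. 0 \<le> R k" "\<And>k. 0 \<le> A k" and sum: "summable (\<lambda>k. A k * R k ^ DIM('a))"
  shows "(\<integral>\<^sup>+ z. f z \<partial>lborel) < \<infinity>"
proof -
  let ?g = "\<lambda>k z. ennreal (A k) * indicator (cball (0::'a) (R k)) z"
  have "f z \<le> (\<Sum>k. ?g k z)" for z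
  proof (cases "f z = 0")
    case False
    then obtain k where k: "norm z \<le> R k" "f z \<le> ennreal (A k)" using cover by blast
    then have "f z \<le> ?g k z" by simp
    also have "\<dots> = (\<Sum>i\<in>{k}. ?g i z)" by (subst sum.insert) simp_all
    also have "\<dots> \<le> (\<Sum>k. ?g k z)" by (rule sum_le_suminf) auto
    finally show ?thesis .
  qed simp
  then have "(\<integral>\<^sup>+ z. f z \<partial>lborel) \<le> (\<integral>\<^sup>+ z. (\<Sum>k. ?g k z) \<partial>lborel)" by (intro nn_integral_mono)
  also have "\<dots> = (\<Sum>k. \<integral>\<^sup>+ z. ?g k z \<partial>lborel)"
    by (intro nn_integral_suminf borel_measurable_times_ennreal borel_measurable_const borel_measurable_indicator) auto
  also have "\<dots> = (\<Sum>k. ennreal (unit_ball_vol DIM('a) * (A k * R k ^ DIM('a))))"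
    using nonneg by (intro suminf_cong) (simp add: nn_integral_cmult_indicator emeasure_cball ennreal_mult''[symmetric] mult_ac)
  also have "\<dots> = ennreal (\<Sum>k. unit_ball_vol DIM('a) * (A k * R k ^ DIM('a)))"
    using nonneg by (intro suminf_ennreal2 summable_mult sum) auto
  finally show ?thesis by (simp add: order_le_less_trans)
qed

lemma one_minus_cos_le: "1 - cos t \<le> t\<^sup>2" for t :: real
proof -
  have "\<bar>sin (t / 2)\<bar> \<le> \<bar>t / 2\<bar>" by (rule abs_sin_x_le_abs_x)
  then have "(sin (t / 2))\<^sup>2 \<le> (t / 2)\<^sup>2" by (simp only: abs_le_square_iff)
  then have "(sin (t / 2))\<^sup>2 \<le> t\<^sup>2 / 4" by (simp add: power_divide)
  moreover have "cos t = 1 - 2 * (sin (t / 2))\<^sup>2" using cos_double_sin[of "t / 2"] by simp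
  ultimately show ?thesis using zero_le_power2[of "sin (t / 2)"] by linarith
qed

lemma half_power_cover:
  assumes "0 < t" "t \<le> (1::real)"
  shows "\<exists>j. (1/2) ^ Suc j < t \<and> t \<le> (1/2) ^ j"
proof -
  define j where "j = (LEAST j. (1/2) ^ Suc j < t)"
  obtain n where "(1/2) ^ n < t" using real_arch_pow_inv[of t "1/2"] assms by auto
  then have "(1/2) ^ Suc n < t" by (rule le_less_trans[rotated]) simp
  then have j: "(1/2) ^ Suc j < t" unfolding j_def by (rule LeastI)
  have "t \<le> (1/2) ^ j"
  proof (cases j)
    case (Suc i)
    then have "\<not> (1/2) ^ Suc i < t" unfolding j_def by (metis lessI not_less_Least)
    then show ?thesis using Suc by simp
  qed (use assms in simp)
  with j show ?thesis by blast
qed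

lemma first_basis_in_Basis: "first_basis \<in> Basis"
  unfolding first_basis_def by (rule someI_ex) (use nonempty_Basis in blast)

text \<open>Near the origin the numerator is at most \<open>(norm z)\<^sup>2\<close>, and the dyadic
  series has ratio \<open>(1/2) powr (2 - 2 * s)\<close>, below 1 as s < 1. Away from it the
  numerator is at most 2, and the ratio is \<open>2 powr (- 2 * s)\<close>, below 1 as s >
  0.\<close>

lemma frac_const_integral_finite:
  fixes b :: "'a::euclidean_space"
  assumes b: "b \<in> Basis" and s: "0 < s" "s < 1" and N: "DIM('a) \<ge> 2"
  shows "(\<integral>\<^sup>+ z. ennreal ((1 - cos (z \<bullet> b)) / norm z powr (real DIM('a) + 2 * s)) \<partial>lborel) < \<infinity>"
proof -
  let ?p = "real DIM('a) + 2 * s"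
  let ?f = "\<lambda>z::'a. ennreal ((1 - cos (z \<bullet> b)) / norm z powr ?p)"
  have "(\<integral>\<^sup>+ z. ?f z * indicator {z. norm z \<le> 1} z \<partial>lborel) < \<infinity>"
  proof (rule nn_integral_finite_by_balls[where R = "\<lambda>j. (1/2) ^ j" and A = "\<lambda>j. ((1/2) ^ Suc j) powr (2 - ?p)"])
    fix z :: 'a assume "?f z * indicator {z. norm z \<le> 1} z \<noteq> 0"
    then have z: "0 < norm z" "norm z \<le> 1" by (auto simp: indicator_def split: if_splits)
    obtain j where j: "(1/2) ^ Suc j < norm z" "norm z \<le> (1/2) ^ j" using half_power_cover[OF z] by blast
    have "1 - cos (z \<bullet> b) \<le> (z \<bullet> b)\<^sup>2" by (rule one_minus_cos_le)
    also have "\<dots> \<le> (norm z)\<^sup>2"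
      using Cauchy_Schwarz_ineq2[of z b] b by (simp add: abs_le_square_iff[symmetric])
    finally have "(1 - cos (z \<bullet> b)) / norm z powr ?p \<le> (norm z)\<^sup>2 / norm z powr ?p"
      by (intro divide_right_mono) auto
    also have "\<dots> = norm z powr (2 - ?p)"
      using z by (simp add: powr_diff)
    also have "\<dots> \<le> ((1/2) ^ Suc j) powr (2 - ?p)"
      using j N s by (intro powr_mono2') auto
    finally have "?f z \<le> ennreal (((1/2) ^ Suc j) powr (2 - ?p))" by (rule ennreal_leI)
    then show "\<exists>k. norm z \<le> (1/2) ^ k \<and> ?f z * indicator {z. norm z \<le> 1} z \<le> ennreal (((1/2) ^ Suc k) powr (2 - ?p))"
      using j z by (intro exI[of _ j]) auto
  next
    have e: "((1/2) ^ Suc k) powr (2 - ?p) * ((1/2) ^ k) ^ DIM('a) = (1/2) powr (2 - ?p) * ((1/2) powr (2 - 2 * s)) ^ k" for k :: nat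
    proof -
      have x: "((1/2::real) ^ k) powr c = ((1/2) powr c) ^ k" for c
        by (simp add: powr_realpow[symmetric] powr_powr mult.commute)
      have y: "((1/2::real) ^ k) ^ DIM('a) = (((1/2) powr real DIM('a))) ^ k"
        by (simp add: powr_realpow power_mult[symmetric] mult.commute)
      have "(1/2::real) powr (2 - 2 * s) = (1/2) powr (2 - ?p) * (1/2) powr real DIM('a)"
        unfolding powr_add[symmetric] by simp
      then show ?thesis unfolding power_Suc powr_mult x y by (simp add: power_mult_distrib)
    qed
    have "(1/2::real) powr (2 - 2 * s) < 1" using s powr_less_mono'[of "1/2::real" 0 "2 - 2 * s"] by simp
    then show "summable (\<lambda>k. ((1/2) ^ Suc k) powr (2 - ?p) * ((1/2) ^ k) ^ DIM('a))"
      unfolding e by (intro summable_mult summable_geometric) simp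
  qed auto
  moreover have "(\<integral>\<^sup>+ z. ?f z * indicator {z. 1 < norm z} z \<partial>lborel) < \<infinity>"
  proof (rule nn_integral_finite_by_balls[where R = "\<lambda>j. 4 * 2 ^ j" and A = "\<lambda>j. 2 * (2 ^ j) powr (- ?p)"])
    fix z :: 'a assume "?f z * indicator {z. 1 < norm z} z \<noteq> 0"
    then have z: "1 < norm z" by (auto simp: indicator_def split: if_splits)
    obtain j where "z \<in> shell (2 ^ j * 1) (3 * (2 ^ j * 1))" using shell_chain_cover[of 1 z] z by auto
    then have j: "2 ^ j < norm z" "norm z \<le> 4 * 2 ^ j" by (auto simp: shell_def)
    have "(1 - cos (z \<bullet> b)) / norm z powr ?p \<le> 2 / norm z powr ?p"
      using cos_ge_minus_one[of "z \<bullet> b"] by (intro divide_right_mono) (simp_all del: cos_ge_minus_one)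
    also have "\<dots> = 2 * norm z powr (- ?p)" by (simp only: powr_minus divide_inverse)
    also have "\<dots> \<le> 2 * (2 ^ j) powr (- ?p)"
      using j s by (intro mult_left_mono powr_mono2') auto
    finally have "?f z \<le> ennreal (2 * (2 ^ j) powr (- ?p))" by (rule ennreal_leI)
    then show "\<exists>k. norm z \<le> 4 * 2 ^ k \<and> ?f z * indicator {z. 1 < norm z} z \<le> ennreal (2 * (2 ^ k) powr (- ?p))"
      using j z by (intro exI[of _ j]) auto
  next
    have e: "2 * (2 ^ k) powr (- ?p) * (4 * 2 ^ k) ^ DIM('a) = (2 * 4 ^ DIM('a)) * (2 powr (- 2 * s)) ^ k" for k :: nat
    proof -
      have x: "((2::real) ^ k) powr c = (2 powr c) ^ k" for c
        by (simp add: powr_realpow[symmetric] powr_powr mult.commute)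
      have y: "((2::real) ^ k) ^ DIM('a) = ((2 powr real DIM('a))) ^ k"
        by (simp add: powr_realpow power_mult[symmetric] mult.commute)
      have "(2::real) powr (- 2 * s) = 2 powr (- ?p) * 2 powr real DIM('a)"
        unfolding powr_add[symmetric] by simp
      then show ?thesis unfolding power_mult_distrib x y by (simp add: power_mult_distrib)
    qed
    have "(2::real) powr (- 2 * s) < 1" using s powr_less_mono[of "- 2 * s" 0 "2::real"] by simp
    then show "summable (\<lambda>k. 2 * (2 ^ k) powr (- ?p) * (4 * 2 ^ k) ^ DIM('a))"
      unfolding e by (intro summable_mult summable_geometric) simp
  qed auto
  moreover have "(\<integral>\<^sup>+ z. ?f z \<partial>lborel) = (\<integral>\<^sup>+ z. ?f z * indicator {z. norm z \<le> 1} z + ?f z * indicator {z. 1 < norm z} z \<partial>lborel)"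
    by (intro nn_integral_cong) (auto simp: indicator_def)
  moreover have "\<dots> = (\<integral>\<^sup>+ z. ?f z * indicator {z. norm z \<le> 1} z \<partial>lborel) + (\<integral>\<^sup>+ z. ?f z * indicator {z. 1 < norm z} z \<partial>lborel)"
    by (rule nn_integral_add) measurable
  ultimately show ?thesis by (simp add: less_top)
qed

text \<open>On the ball of radius 1/2 around \<open>b\<close> the product
  \<open>z \<bullet> b\<close> stays between 1/2 and 3/2, inside the interval from 0 to \<pi>, so
  the integrand is positive there.\<close>

lemma frac_const_integral_pos:
  fixes b :: "'a::euclidean_space"
  assumes b: "b \<in> Basis"
  shows "(\<integral>\<^sup>+ z. ennreal ((1 - cos (z \<bullet> b)) / norm z powr p) \<partial>lborel) \<noteq> 0"
proof
  assume "(\<integral>\<^sup>+ z. ennreal ((1 - cos (z \<bullet> b)) / norm z powr p) \<partial>lborel) = 0"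
  then have "AE z in lborel. ennreal ((1 - cos (z \<bullet> b)) / norm z powr p) = 0"
    by (subst (asm) nn_integral_0_iff_AE) measurable
  then have "AE z in lborel. z \<in> ball b (1/2) \<longrightarrow> ennreal ((1 - cos (z \<bullet> b)) / norm z powr p) = 0"
    by eventually_elim simp
  moreover have "0 < emeasure lborel (ball b (1/2))" by (simp add: emeasure_ball_ennreal)
  ultimately have "\<exists>z\<in>ball b (1/2). ennreal ((1 - cos (z \<bullet> b)) / norm z powr p) = 0"
    by (intro AE_imp_exists_on[where M = lborel]) auto
  then obtain z where z: "z \<in> ball b (1/2)" "ennreal ((1 - cos (z \<bullet> b)) / norm z powr p) = 0" by blast
  have "\<bar>(z - b) \<bullet> b\<bar> \<le> norm (z - b) * norm b" by (rule Cauchy_Schwarz_ineq2)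
  also have "\<dots> < 1/2" using z(1) b by (simp add: dist_norm norm_minus_commute)
  finally have "\<bar>z \<bullet> b - 1\<bar> < 1/2" using b by (simp add: inner_diff_left)
  then have zb: "1/2 < z \<bullet> b" "z \<bullet> b < 3/2" by linarith+
  have "cos (z \<bullet> b) < cos 0" using zb pi_gt3 by (intro cos_monotone_0_pi) auto
  moreover have "norm z > 0" using zb by auto
  ultimately show False using z(2) by (auto simp: ennreal_eq_0_iff divide_le_0_iff)
qed

text \<open>Both \<open>enn2real\<close> of infinity and \<open>inverse\<close> of 0 are 0, so an
  infinite or a vanishing integral would make the constant 0 and the norm blind to the energy. The
  two preceding lemmas exclude this.\<close>

lemma frac_const_pos:
  assumes "DIM('a::euclidean_space) \<ge> 2" "0 < s" "s < 1"
  shows "0 < frac_const TYPE('a) s"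
  unfolding frac_const_def
  using frac_const_integral_finite[OF first_basis_in_Basis assms(2,3,1)]
    frac_const_integral_pos[OF first_basis_in_Basis[where 'a='a], of "real DIM('a) + 2 * s"]
  by (simp add: enn2real_positive_iff zero_less_iff_neq_zero)

section \<open>The radial space\<close>

text \<open>\<open>W\<close> is continuous only on the positive half-line and \<open>W 0\<close> is
  arbitrary, so the origin is treated as a separate case.\<close>

lemma measurable_comp_norm:
  fixes W :: "real \<Rightarrow> real"
  assumes "continuous_on {0<..} W"
  shows "(\<lambda>x::'a::euclidean_space. W (norm x)) \<in> borel_measurable borel"
proof -
  have [measurable]: "(\<lambda>t. indicator {0<..} t *\<^sub>R W t) \<in> borel_measurable borel"
    by (rule borel_measurable_continuous_on_indicator) (use assms in auto)
  have "(\<lambda>x::'a. if x = 0 then W 0 else indicator {0<..} (norm x) *\<^sub>R W (norm x)) \<in> borel_measurable borel"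
    by measurable
  also have "(\<lambda>x::'a. if x = 0 then W 0 else indicator {0<..} (norm x) *\<^sub>R W (norm x)) = (\<lambda>x. W (norm x))"
    by auto
  finally show ?thesis .
qed

lemma AE_nonzero: "AE x in lborel. x \<noteq> (0::'a::euclidean_space)"
  by (rule AE_lborel_singleton)

lemma gagliardo_sq_eq:
  "gagliardo_sq s (u :: 'a::euclidean_space \<Rightarrow> real) = ennreal (frac_const TYPE('a) s / 2) * gagliardo_int s u"
  by (simp add: gagliardo_sq_def gagliardo_int_def)

text \<open>Finiteness of both summands lets \<open>enn2real\<close> in \<open>HsV_norm\<close> be
  undone; the last clause moves between the real norm and \<open>ennreal\<close>
  inequalities.\<close>

lemma HsV_radD:
  fixes u :: "'a::euclidean_space \<Rightarrow> real"
  assumes "u \<in> HsV_rad s V"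
  shows "u \<in> borel_measurable borel" "radial u"
    "(\<integral>\<^sup>+ x. ennreal (\<bar>u x\<bar> powr frac_crit TYPE('a) s) \<partial>lborel) < \<infinity>"
    "gagliardo_sq s u < \<infinity>" "V_integral V u < \<infinity>"
    "gagliardo_sq s u + V_integral V u = ennreal ((HsV_norm s V u)\<^sup>2)"
  using assms by (auto simp: HsV_rad_def HsV_def dotH_def HsV_norm_def less_top[symmetric])

lemma HsV_norm_nonneg: "0 \<le> HsV_norm s V u"
  by (simp add: HsV_norm_def)

section \<open>Multiples and differences in the radial space\<close>

lemma gagliardo_int_cmult:
  fixes u :: "'a::euclidean_space \<Rightarrow> real"
  assumes [measurable]: "u \<in> borel_measurable borel"
  shows "gagliardo_int s (\<lambda>x. a * u x) = ennreal (a\<^sup>2) * gagliardo_int s u"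
proof -
  have "gagliardo_int s (\<lambda>x. a * u x) = (\<integral>\<^sup>+ p. ennreal (a\<^sup>2) * ennreal ((u (fst p) - u (snd p))^2 / norm (fst p - snd p) powr (real DIM('a) + 2 * s))
        \<partial>(lborel \<Otimes>\<^sub>M lborel))"
    unfolding gagliardo_int_def
    by (simp add: ennreal_mult'[symmetric] right_diff_distrib[symmetric] power_mult_distrib)
  also have "\<dots> = ennreal (a\<^sup>2) * gagliardo_int s u"
    unfolding gagliardo_int_def by (rule nn_integral_cmult) measurable
  finally show ?thesis .
qed

lemma V_integral_cmult:
  fixes u :: "'a::euclidean_space \<Rightarrow> real"
  assumes V: "continuous_on {0<..} V" and [measurable]: "u \<in> borel_measurable borel"
  shows "V_integral V (\<lambda>x. a * u x) = ennreal (a\<^sup>2) * V_integral V u"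
proof -
  note [measurable] = measurable_comp_norm[OF V, where 'a='a]
  have "V_integral V (\<lambda>x. a * u x) = (\<integral>\<^sup>+ x. ennreal (a\<^sup>2) * ennreal (V (norm x) * (u x)^2) \<partial>lborel)"
    unfolding V_integral_def by (simp add: ennreal_mult'[symmetric] power_mult_distrib mult_ac)
  also have "\<dots> = ennreal (a\<^sup>2) * V_integral V u"
    unfolding V_integral_def by (rule nn_integral_cmult) measurable
  finally show ?thesis .
qed

lemma HsV_rad_cmult:
  fixes u :: "'a::euclidean_space \<Rightarrow> real"
  assumes V: "continuous_on {0<..} V" and u: "u \<in> HsV_rad s V"
  shows "(\<lambda>x. a * u x) \<in> HsV_rad s V" and "HsV_norm s V (\<lambda>x. a * u x) = \<bar>a\<bar> * HsV_norm s V u"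
proof -
  note D = HsV_radD[OF u]
  note [measurable] = D(1)
  have g: "gagliardo_sq s (\<lambda>x. a * u x) = ennreal (a\<^sup>2) * gagliardo_sq s u"
    by (simp add: gagliardo_sq_eq gagliardo_int_cmult mult_ac)
  have v: "V_integral V (\<lambda>x. a * u x) = ennreal (a\<^sup>2) * V_integral V u"
    by (rule V_integral_cmult[OF V D(1)])
  let ?p = "frac_crit TYPE('a) s"
  have "(\<integral>\<^sup>+ x. ennreal (\<bar>a * u x\<bar> powr ?p) \<partial>lborel) = (\<integral>\<^sup>+ x. ennreal (\<bar>a\<bar> powr ?p) * ennreal (\<bar>u x\<bar> powr ?p) \<partial>lborel)"
    by (simp add: abs_mult powr_mult ennreal_mult')
  also have "\<dots> = ennreal (\<bar>a\<bar> powr ?p) * (\<integral>\<^sup>+ x. ennreal (\<bar>u x\<bar> powr ?p) \<partial>lborel)"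
    by (rule nn_integral_cmult) measurable
  also have "\<dots> < \<infinity>" using D(3) by (simp add: ennreal_mult_less_top)
  finally have p: "(\<integral>\<^sup>+ x. ennreal (\<bar>a * u x\<bar> powr ?p) \<partial>lborel) < \<infinity>" .
  have "radial (\<lambda>x. a * u x)" using D(2) unfolding radial_def by metis
  then show "(\<lambda>x. a * u x) \<in> HsV_rad s V"
    using p D(4,5) by (simp add: HsV_rad_def HsV_def dotH_def g v ennreal_mult_less_top)
  show "HsV_norm s V (\<lambda>x. a * u x) = \<bar>a\<bar> * HsV_norm s V u"
    by (simp add: HsV_norm_def g v distrib_left[symmetric] enn2real_mult real_sqrt_mult)
qed

lemma square_diff_le: "(a - b)\<^sup>2 \<le> 2 * a\<^sup>2 + 2 * b\<^sup>2" for a b :: real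
  using zero_le_power2[of "a + b"] by (simp add: power2_eq_square algebra_simps)

lemma ennreal_double_add: "0 \<le> a \<Longrightarrow> 0 \<le> b \<Longrightarrow> ennreal (2 * a + 2 * b) = 2 * ennreal a + 2 * ennreal b"
  by (simp add: ennreal_mult')

lemma gagliardo_int_diff_le:
  fixes u v :: "'a::euclidean_space \<Rightarrow> real"
  assumes [measurable]: "u \<in> borel_measurable borel" "v \<in> borel_measurable borel"
  shows "gagliardo_int s (\<lambda>x. u x - v x) \<le> 2 * gagliardo_int s u + 2 * gagliardo_int s v"
proof -
  let ?k = "\<lambda>w p. ennreal ((w (fst p) - w (snd p))^2 / norm (fst p - snd p :: 'a) powr (real DIM('a) + 2 * s))"
  have "?k (\<lambda>x. u x - v x) p \<le> 2 * ?k u p + 2 * ?k v p" for p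
  proof -
    define d where "d = norm (fst p - snd p) powr (real DIM('a) + 2 * s)"
    have "((u (fst p) - v (fst p)) - (u (snd p) - v (snd p)))\<^sup>2 / d \<le>
       (2 * (u (fst p) - u (snd p))\<^sup>2 + 2 * (v (fst p) - v (snd p))\<^sup>2) / d"
      using square_diff_le[of "u (fst p) - u (snd p)" "v (fst p) - v (snd p)"]
      by (intro divide_right_mono) (auto simp: d_def algebra_simps)
    also have "\<dots> = 2 * ((u (fst p) - u (snd p))\<^sup>2 / d) + 2 * ((v (fst p) - v (snd p))\<^sup>2 / d)"
      by (simp add: add_divide_distrib)
    finally have "ennreal (((u (fst p) - v (fst p)) - (u (snd p) - v (snd p)))\<^sup>2 / d)
      \<le> ennreal (2 * ((u (fst p) - u (snd p))\<^sup>2 / d) + 2 * ((v (fst p) - v (snd p))\<^sup>2 / d))" by (rule ennreal_leI)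
    also have "\<dots> = 2 * ennreal ((u (fst p) - u (snd p))\<^sup>2 / d) + 2 * ennreal ((v (fst p) - v (snd p))\<^sup>2 / d)"
      by (rule ennreal_double_add) (auto simp: d_def)
    finally show ?thesis by (simp only: d_def)
  qed
  then have "gagliardo_int s (\<lambda>x. u x - v x) \<le> (\<integral>\<^sup>+ p. 2 * ?k u p + 2 * ?k v p \<partial>(lborel \<Otimes>\<^sub>M lborel))"
    unfolding gagliardo_int_def by (rule nn_integral_mono)
  also have "\<dots> = (\<integral>\<^sup>+ p. 2 * ?k u p \<partial>(lborel \<Otimes>\<^sub>M lborel)) + (\<integral>\<^sup>+ p. 2 * ?k v p \<partial>(lborel \<Otimes>\<^sub>M lborel))"
    by (rule nn_integral_add) measurable
  also have "(\<integral>\<^sup>+ p. 2 * ?k u p \<partial>(lborel \<Otimes>\<^sub>M lborel)) = 2 * gagliardo_int s u"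
    unfolding gagliardo_int_def by (rule nn_integral_cmult) measurable
  also have "(\<integral>\<^sup>+ p. 2 * ?k v p \<partial>(lborel \<Otimes>\<^sub>M lborel)) = 2 * gagliardo_int s v"
    unfolding gagliardo_int_def by (rule nn_integral_cmult) measurable
  finally show ?thesis .
qed

lemma V_integral_diff_le:
  fixes u v :: "'a::euclidean_space \<Rightarrow> real"
  assumes V: "continuous_on {0<..} V" "\<And>t. t > 0 \<Longrightarrow> V t \<ge> 0"
    and [measurable]: "u \<in> borel_measurable borel" "v \<in> borel_measurable borel"
  shows "V_integral V (\<lambda>x. u x - v x) \<le> 2 * V_integral V u + 2 * V_integral V v"
proof -
  note [measurable] = measurable_comp_norm[OF V(1), where 'a='a]
  let ?k = "\<lambda>w x. ennreal (V (norm (x::'a)) * (w x)\<^sup>2)"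
  have "AE x in lborel. ?k (\<lambda>x. u x - v x) x \<le> 2 * ?k u x + 2 * ?k v x"
    using AE_nonzero
  proof eventually_elim
    case (elim x)
    then have Vx: "0 \<le> V (norm x)" by (intro V(2)) simp
    then have "V (norm x) * (u x - v x)\<^sup>2 \<le> 2 * (V (norm x) * (u x)\<^sup>2) + 2 * (V (norm x) * (v x)\<^sup>2)"
      using mult_left_mono[OF square_diff_le[of "u x" "v x"] Vx] by (simp add: algebra_simps)
    then have "?k (\<lambda>x. u x - v x) x \<le> ennreal (2 * (V (norm x) * (u x)\<^sup>2) + 2 * (V (norm x) * (v x)\<^sup>2))"
      by (rule ennreal_leI)
    also have "\<dots> = 2 * ?k u x + 2 * ?k v x" using Vx by (intro ennreal_double_add) auto
    finally show ?case .
  qed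
  then have "V_integral V (\<lambda>x. u x - v x) \<le> (\<integral>\<^sup>+ x. 2 * ?k u x + 2 * ?k v x \<partial>lborel)"
    unfolding V_integral_def by (rule nn_integral_mono_AE)
  also have "\<dots> = (\<integral>\<^sup>+ x. 2 * ?k u x \<partial>lborel) + (\<integral>\<^sup>+ x. 2 * ?k v x \<partial>lborel)"
    by (rule nn_integral_add) measurable
  also have "(\<integral>\<^sup>+ x. 2 * ?k u x \<partial>lborel) = 2 * V_integral V u"
    unfolding V_integral_def by (rule nn_integral_cmult) measurable
  also have "(\<integral>\<^sup>+ x. 2 * ?k v x \<partial>lborel) = 2 * V_integral V v"
    unfolding V_integral_def by (rule nn_integral_cmult) measurable
  finally show ?thesis .
qed

lemma abs_diff_powr_le:
  fixes a b :: real
  assumes "0 < p"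
  shows "\<bar>a - b\<bar> powr p \<le> 2 powr p * (\<bar>a\<bar> powr p + \<bar>b\<bar> powr p)"
proof -
  have "\<bar>a - b\<bar> powr p \<le> (2 * max \<bar>a\<bar> \<bar>b\<bar>) powr p" using assms by (intro powr_mono2) auto
  also have "\<dots> = 2 powr p * (max \<bar>a\<bar> \<bar>b\<bar>) powr p" by (simp add: powr_mult)
  also have "\<dots> \<le> 2 powr p * (\<bar>a\<bar> powr p + \<bar>b\<bar> powr p)" by (intro mult_left_mono) (auto simp: max_def)
  finally show ?thesis .
qed

text \<open>Pointwise \<open>(a - b)\<^sup>2 \<le> 2 * a\<^sup>2 + 2 * b\<^sup>2\<close> bounds the
  squared norm by \<open>4 * M\<^sup>2\<close>. This is the bound the triangle inequality would give
  for two functions of norm at most \<open>M\<close>, obtained without Minkowski's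
  inequality.\<close>

lemma HsV_rad_diff:
  fixes u v :: "'a::euclidean_space \<Rightarrow> real"
  assumes V: "continuous_on {0<..} V" "\<And>t. t > 0 \<Longrightarrow> V t \<ge> 0"
    and N: "2 * s < real DIM('a)"
    and u: "u \<in> HsV_rad s V" and v: "v \<in> HsV_rad s V"
  shows "(\<lambda>x. u x - v x) \<in> HsV_rad s V"
    and "HsV_norm s V u \<le> M \<Longrightarrow> HsV_norm s V v \<le> M \<Longrightarrow> HsV_norm s V (\<lambda>x. u x - v x) \<le> 2 * M"
proof -
  note Du = HsV_radD[OF u] and Dv = HsV_radD[OF v]
  note [measurable] = Du(1) Dv(1)
  have g: "gagliardo_sq s (\<lambda>x. u x - v x) \<le> 2 * gagliardo_sq s u + 2 * gagliardo_sq s v"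
    using mult_left_mono[OF gagliardo_int_diff_le[OF Du(1) Dv(1), of s], of "ennreal (frac_const TYPE('a) s / 2)"]
    by (simp add: gagliardo_sq_eq distrib_left mult_ac)
  have w: "V_integral V (\<lambda>x. u x - v x) \<le> 2 * V_integral V u + 2 * V_integral V v"
    by (rule V_integral_diff_le[OF V Du(1) Dv(1)])
  let ?p = "frac_crit TYPE('a) s"
  have p0: "0 < ?p" using N by (simp add: frac_crit_def)
  have "(\<integral>\<^sup>+ x. ennreal (\<bar>u x - v x\<bar> powr ?p) \<partial>lborel)
      \<le> (\<integral>\<^sup>+ x. ennreal (2 powr ?p) * (ennreal (\<bar>u x\<bar> powr ?p) + ennreal (\<bar>v x\<bar> powr ?p)) \<partial>lborel)"
    using abs_diff_powr_le[OF p0]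
    by (intro nn_integral_mono) (auto simp: ennreal_plus[symmetric] ennreal_mult'[symmetric] intro!: ennreal_leI simp del: ennreal_plus)
  also have "\<dots> = ennreal (2 powr ?p) * ((\<integral>\<^sup>+ x. ennreal (\<bar>u x\<bar> powr ?p) \<partial>lborel) + (\<integral>\<^sup>+ x. ennreal (\<bar>v x\<bar> powr ?p) \<partial>lborel))"
    by (simp add: nn_integral_cmult nn_integral_add)
  also have "\<dots> < \<infinity>" using Du(3) Dv(3) by (simp add: ennreal_mult_less_top)
  finally have "(\<integral>\<^sup>+ x. ennreal (\<bar>u x - v x\<bar> powr ?p) \<partial>lborel) < \<infinity>" .
  moreover have "radial (\<lambda>x. u x - v x)" using Du(2) Dv(2) unfolding radial_def by metis
  moreover have "gagliardo_sq s (\<lambda>x. u x - v x) < \<infinity>"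
    using g Du(4) Dv(4) by (simp add: ennreal_mult_less_top order_le_less_trans)
  moreover have "V_integral V (\<lambda>x. u x - v x) < \<infinity>"
    using w Du(5) Dv(5) by (simp add: ennreal_mult_less_top order_le_less_trans)
  ultimately show uv: "(\<lambda>x. u x - v x) \<in> HsV_rad s V"
    by (simp add: HsV_rad_def HsV_def dotH_def)
  assume M: "HsV_norm s V u \<le> M" "HsV_norm s V v \<le> M"
  have M0: "0 \<le> M" using HsV_norm_nonneg[of s V u] M(1) by linarith
  have "ennreal ((HsV_norm s V (\<lambda>x. u x - v x))\<^sup>2) \<le> 2 * (gagliardo_sq s u + V_integral V u) + 2 * (gagliardo_sq s v + V_integral V v)"
    unfolding HsV_radD(6)[OF uv, symmetric] using add_mono[OF g w] by (simp add: distrib_left add_ac)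
  also have "\<dots> = ennreal (2 * (HsV_norm s V u)\<^sup>2 + 2 * (HsV_norm s V v)\<^sup>2)"
    unfolding Du(6) Dv(6) by (simp add: ennreal_mult')
  also have "\<dots> \<le> ennreal (2 * M\<^sup>2 + 2 * M\<^sup>2)"
    using M by (intro ennreal_leI add_mono mult_left_mono power_mono) (auto simp: HsV_norm_nonneg)
  finally have "(HsV_norm s V (\<lambda>x. u x - v x))\<^sup>2 \<le> 2 * M\<^sup>2 + 2 * M\<^sup>2"
    by (subst (asm) ennreal_le_iff) simp_all
  also have "\<dots> = (2 * M)\<^sup>2" by (simp add: power_mult_distrib)
  finally have "(HsV_norm s V (\<lambda>x. u x - v x))\<^sup>2 \<le> (2 * M)\<^sup>2" .
  then show "HsV_norm s V (\<lambda>x. u x - v x) \<le> 2 * M" by (rule power2_le_imp_le) (use M0 in simp)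
qed

lemma HsV_rad_gagliardo_int_le:
  fixes u :: "'a::euclidean_space \<Rightarrow> real"
  assumes N: "DIM('a) \<ge> 2" "0 < s" "s < 1" and u: "u \<in> HsV_rad s V" "HsV_norm s V u \<le> M"
  shows "gagliardo_int s u \<le> ennreal ((M * sqrt (2 / frac_const TYPE('a) s))\<^sup>2)"
proof -
  define c where "c = frac_const TYPE('a) s / 2"
  have c: "c > 0" using frac_const_pos[OF N] by (simp add: c_def)
  have "ennreal c * gagliardo_int s u \<le> gagliardo_sq s u + V_integral V u"
    by (simp add: gagliardo_sq_eq c_def)
  also have "\<dots> = ennreal ((HsV_norm s V u)\<^sup>2)" by (rule HsV_radD(6)[OF u(1)])
  also have "\<dots> \<le> ennreal (M\<^sup>2)" using u(2) by (intro ennreal_leI power_mono HsV_norm_nonneg)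
  also have "M\<^sup>2 = c * (M * sqrt (2 / frac_const TYPE('a) s))\<^sup>2"
    using c by (simp add: c_def power_mult_distrib)
  also have "ennreal (c * (M * sqrt (2 / frac_const TYPE('a) s))\<^sup>2) = ennreal c * ennreal ((M * sqrt (2 / frac_const TYPE('a) s))\<^sup>2)"
    using c by (intro ennreal_mult) auto
  finally show ?thesis using c by (simp add: ennreal_mult_le_mult_iff)
qed

lemma HsV_rad_AE_bound:
  assumes N: "DIM('a::euclidean_space) \<ge> 2" and s: "1/2 < s" "s < 1" and a: "0 < a"
  shows "\<exists>C>0. \<forall>(u::'a \<Rightarrow> real) M. u \<in> HsV_rad s V \<longrightarrow> HsV_norm s V u \<le> M \<longrightarrow> 0 < M \<longrightarrow>
     (AE x in lborel. a < norm x \<longrightarrow> \<bar>u x\<bar> \<le> C * M)"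
proof -
  obtain C where C: "C > 0" "\<And>(u::'a \<Rightarrow> real) M p. u \<in> borel_measurable borel \<Longrightarrow> radial u \<Longrightarrow> 0 < p \<Longrightarrow>
     (\<integral>\<^sup>+ x. ennreal (\<bar>u x\<bar> powr p) \<partial>lborel) < \<infinity> \<Longrightarrow> 0 < M \<Longrightarrow> gagliardo_int s u \<le> ennreal (M\<^sup>2) \<Longrightarrow>
     (AE x in lborel. a < norm x \<longrightarrow> \<bar>u x\<bar> \<le> C * M)"
    using radial_AE_bound[OF N s a] by blast
  define k where "k = sqrt (2 / frac_const TYPE('a) s)"
  have k: "k > 0" using frac_const_pos[OF N _ s(2)] s by (simp add: k_def)
  have p: "0 < frac_crit TYPE('a) s" using N s by (simp add: frac_crit_def)
  have "AE x in lborel. a < norm x \<longrightarrow> \<bar>u x\<bar> \<le> C * k * M"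
    if u: "u \<in> HsV_rad s V" "HsV_norm s V u \<le> M" "0 < M" for u :: "'a \<Rightarrow> real" and M
    using C(2)[OF HsV_radD(1,2)[OF u(1)] p HsV_radD(3)[OF u(1)], of "M * k"] k u
      HsV_rad_gagliardo_int_le[OF N _ s(2) u(1,2)] s by (simp add: k_def mult_ac)
  then show ?thesis using C(1) k by (intro exI[of _ "C * k"]) auto
qed

section \<open>Almost everywhere convergent subsequences\<close>

lemma diagonal_convergent_subsequence:
  fixes c :: "nat \<Rightarrow> nat \<Rightarrow> real"
  assumes "\<And>i. bounded (range (c i))"
  shows "\<exists>r. strict_mono r \<and> (\<forall>i. convergent (\<lambda>n. c i (r n)))"
proof -
  interpret subseqs "\<lambda>i r. convergent (\<lambda>n. c i (r n))"
  proof
    fix i and t :: "nat \<Rightarrow> nat"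
    have "bounded (range (\<lambda>n. c i (t n)))" by (rule bounded_subset[OF assms[of i]]) auto
    then show "\<exists>r'. strict_mono r' \<and> convergent (\<lambda>n. c i ((t \<circ> r') n))"
      using bounded_imp_convergent_subsequence by (fastforce simp: convergent_def o_def)
  qed
  have "convergent (\<lambda>n. c k (diagseq n))" for k
  proof -
    have "convergent (\<lambda>n. c k ((diagseq \<circ> ((+) (Suc k))) n))"
    proof (rule diagseq_holds)
      fix r t :: "nat \<Rightarrow> nat" and n
      assume "strict_mono r" "convergent (\<lambda>m. c n (t m))"
      then show "convergent (\<lambda>m. c n ((t \<circ> r) m))"
        using convergent_subseq_convergent[of "\<lambda>m. c n (t m)" r] by (simp add: o_def)
    qed
    then show ?thesis
      using convergent_ignore_initial_segment[of "\<lambda>n. c k (diagseq n)" "Suc k"] by (simp add: o_def add.commute)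
  qed
  then show ?thesis using subseq_diagseq by blast
qed

text \<open>Thin shells with rational parameters form a countable family; along a diagonal sequence the
  centres of all of them converge, and \<open>f n\<close> stays uniformly close to its centre on a thin shell.\<close>

lemma HsV_rad_AE_convergent_subsequence:
  fixes f :: "nat \<Rightarrow> 'a::euclidean_space \<Rightarrow> real"
  assumes N: "DIM('a) \<ge> 2" and s: "1/2 < s" "s < 1"
    and f: "\<And>n. f n \<in> HsV_rad s V" "\<And>n. HsV_norm s V (f n) \<le> M" and M: "0 < M"
  shows "\<exists>r. strict_mono r \<and> (AE x in lborel. convergent (\<lambda>n. f (r n) x))"
proof -
  define L where "L = chain_const TYPE('a) s * (M * sqrt (2 / frac_const TYPE('a) s))"
  have k: "0 < sqrt (2 / frac_const TYPE('a) s)" using frac_const_pos[OF N _ s(2)] s by simp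
  have L: "L > 0" unfolding L_def using M k chain_const(1)[OF s(1), where 'a='a] by (intro mult_pos_pos)
  \<comment> \<open>All pairs of rationals are enumerated; \<open>valid\<close> picks those that
    describe a thin shell, and the others get the harmless centre 0.\<close>
  define P where "P i = (real_of_rat (fst (from_nat i :: rat \<times> rat)), real_of_rat (snd (from_nat i :: rat \<times> rat)))" for i
  have P: "\<exists>i. P i = (of_rat a, of_rat b)" for a b
    by (rule exI[of _ "to_nat (a, b)"]) (simp add: P_def)
  define S where "S i = (shell (fst (P i)) (snd (P i)) :: 'a set)" for i
  define e where "e i = L * osc_bound TYPE('a) s (fst (P i)) (snd (P i))" for i
  define valid where "valid i \<longleftrightarrow> 0 < fst (P i) \<and> 0 < snd (P i) \<and> snd (P i) \<le> fst (P i)" for i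
  define c where "c i n = (if valid i then (SOME c. AE x in lborel. x \<in> S i \<longrightarrow> \<bar>f n x - c\<bar> \<le> e i) else 0)" for i n
  have c: "AE x in lborel. x \<in> S i \<longrightarrow> \<bar>f n x - c i n\<bar> \<le> e i" if v: "valid i" for i n
  proof -
    have "\<exists>c. AE x in lborel. x \<in> S i \<longrightarrow> \<bar>f n x - c\<bar> \<le> e i"
      using shell_AE_osc[OF HsV_radD(1,2)[OF f(1)] _ _ _ s(1) _ HsV_rad_gagliardo_int_le[OF N _ s(2) f],
          of "fst (P i)" "snd (P i)" n] v M k s
      by (simp add: valid_def S_def e_def L_def mult_ac)
    then have "AE x in lborel. x \<in> S i \<longrightarrow> \<bar>f n x - (SOME c. AE x in lborel. x \<in> S i \<longrightarrow> \<bar>f n x - c\<bar> \<le> e i)\<bar> \<le> e i"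
      by (rule someI_ex)
    then show ?thesis using v by (simp add: c_def)
  qed
  have "bounded (range (c i))" for i
  proof (cases "valid i")
    case True
    then have pos: "0 < fst (P i)" "0 < snd (P i)" by (auto simp: valid_def)
    obtain C where C: "C > 0" "\<And>(u::'a \<Rightarrow> real) M. u \<in> HsV_rad s V \<Longrightarrow> HsV_norm s V u \<le> M \<Longrightarrow> 0 < M \<Longrightarrow>
     (AE x in lborel. fst (P i) < norm x \<longrightarrow> \<bar>u x\<bar> \<le> C * M)"
      using HsV_rad_AE_bound[OF N s pos(1)] by blast
    \<comment> \<open>The centre is compared with \<open>f n x\<close> at a point of the shell where
      the uniform bound and the oscillation bound both hold.\<close>
    have "\<bar>c i n\<bar> \<le> C * M + e i" for n
    proof -
      have "AE x in lborel. x \<in> S i \<longrightarrow> \<bar>c i n\<bar> \<le> C * M + e i"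
        using c[OF True, of n] C(2)[OF f M, of n]
      proof eventually_elim
        case (elim x)
        then show ?case by (auto simp: S_def shell_def)
      qed
      then have "\<exists>x\<in>S i. \<bar>c i n\<bar> \<le> C * M + e i"
        by (rule AE_imp_exists_on) (use shell_pos[OF pos, where 'a='a] in \<open>auto simp: S_def\<close>)
      then show ?thesis by blast
    qed
    then show ?thesis by (intro boundedI[of _ "C * M + e i"]) auto
  next
    case False
    then have "range (c i) \<subseteq> {0}" by (auto simp: c_def)
    then show ?thesis by (rule bounded_subset[rotated]) simp
  qed
  then obtain r where r: "strict_mono r" "\<And>i. convergent (\<lambda>n. c i (r n))"
    using diagonal_convergent_subsequence[of c] by blast
  have "AE x in lborel. \<forall>i n. valid i \<longrightarrow> x \<in> S i \<longrightarrow> \<bar>f n x - c i n\<bar> \<le> e i"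
  proof (subst AE_all_countable, intro allI, subst AE_all_countable, intro allI)
    show "AE x in lborel. valid i \<longrightarrow> x \<in> S i \<longrightarrow> \<bar>f n x - c i n\<bar> \<le> e i" for i n
      using c[of i n] by (cases "valid i") auto
  qed
  then have "AE x in lborel. convergent (\<lambda>n. f (r n) x)"
    using AE_nonzero
  proof eventually_elim
    case (elim x)
    define t where "t = norm x"
    have t: "t > 0" using elim by (simp add: t_def)
    have small: "\<exists>i. valid i \<and> x \<in> S i \<and> e i < \<epsilon>" if \<epsilon>: "0 < \<epsilon>" for \<epsilon>
    proof -
      define b where "b = L * osc_bound TYPE('a) s (t / 2) 1"
      have b: "b > 0" unfolding b_def using L t osc_bound_pos[of "t / 2" 1 s, where 'a='a] by simp
      \<comment> \<open>\<open>l0\<close> solves \<open>b * l0 powr (s - 1/2) = \<epsilon>\<close>,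
        where \<open>b\<close> is the bound for radius \<open>t / 2\<close> and thickness 1. Any
        thinner shell with inner radius at least \<open>t / 2\<close> has
        \<open>e i < \<epsilon>\<close>; the lower limits on \<rho> ensure this radius and that the
        shell reaches \<open>x\<close>.\<close>
      define l0 where "l0 = (\<epsilon> / b) powr (1 / (s - 1/2))"
      have "0 < min l0 (t / 2)" using b \<epsilon> t by (simp add: l0_def)
      then obtain l where l: "0 < real_of_rat l" "real_of_rat l < min l0 (t / 2)"
        using of_rat_dense by blast
      have "max (t / 2) (t - real_of_rat l) < t" using t l by simp
      then obtain \<rho> where \<rho>: "max (t / 2) (t - real_of_rat l) < real_of_rat \<rho>" "real_of_rat \<rho> < t"
        using of_rat_dense by blast
      obtain i where i: "P i = (of_rat \<rho>, of_rat l)" using P by blast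
      have b\<rho>: "0 < real_of_rat \<rho>" "t / 2 \<le> real_of_rat \<rho>" "real_of_rat l \<le> real_of_rat \<rho>" "t \<le> real_of_rat \<rho> + real_of_rat l"
        using l \<rho> t by linarith+
      then have "valid i" unfolding valid_def i fst_conv snd_conv using l(1) by blast
      moreover have "x \<in> S i" unfolding S_def shell_def i fst_conv snd_conv using \<rho>(2) b\<rho>(4) by (simp add: t_def)
      moreover have "e i < \<epsilon>"
      proof -
        have "e i \<le> L * osc_bound TYPE('a) s (t / 2) (of_rat l)"
          unfolding e_def i fst_conv snd_conv using L b\<rho>(2) t by (intro mult_left_mono osc_bound_mono_radius) auto
        also have "\<dots> = b * of_rat l powr (s - 1/2)" by (simp add: b_def osc_bound_def)
        also have "\<dots> < b * (\<epsilon> / b)"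
        proof -
          have "of_rat l powr (s - 1/2) < l0 powr (s - 1/2)" using l s by (intro powr_less_mono2) auto
          also have "l0 powr (s - 1/2) = \<epsilon> / b" using b \<epsilon> s by (simp add: l0_def powr_powr)
          finally show ?thesis using b by (intro mult_strict_left_mono)
        qed
        finally show ?thesis using b by simp
      qed
      ultimately show ?thesis by blast
    qed
    have "Cauchy (\<lambda>n. f (r n) x)"
    proof (rule metric_CauchyI)
      fix d :: real assume "0 < d"
      then obtain i where i: "valid i" "x \<in> S i" "e i < d / 4" using small[of "d / 4"] by auto
      have "Cauchy (\<lambda>n. c i (r n))" using r(2) by (simp add: Cauchy_convergent_iff)
      then obtain n0 where n0: "\<And>m n. n0 \<le> m \<Longrightarrow> n0 \<le> n \<Longrightarrow> dist (c i (r m)) (c i (r n)) < d / 2"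
        using \<open>0 < d\<close> by (meson metric_CauchyD half_gt_zero)
      show "\<exists>n0. \<forall>m\<ge>n0. \<forall>n\<ge>n0. dist (f (r m) x) (f (r n) x) < d"
      proof (intro exI[of _ n0] allI impI)
        fix m n assume "n0 \<le> m" "n0 \<le> n"
        then have "\<bar>c i (r m) - c i (r n)\<bar> < d / 2" using n0 by (simp add: dist_real_def)
        moreover have "\<bar>f (r m) x - c i (r m)\<bar> \<le> e i" "\<bar>f (r n) x - c i (r n)\<bar> \<le> e i" using elim i by auto
        ultimately show "dist (f (r m) x) (f (r n) x) < d" using i(3) unfolding dist_real_def by linarith
      qed
    qed
    then show ?case by (simp add: Cauchy_convergent_iff)
  qed
  with r show ?thesis by blast
qed

section \<open>Weighted integrals over subsets\<close>

definition weighted_int :: "real \<Rightarrow> (real \<Rightarrow> real) \<Rightarrow> 'a::euclidean_space set \<Rightarrow> ('a \<Rightarrow> real) \<Rightarrow> ennreal" where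
  "weighted_int q K A u = (\<integral>\<^sup>+ x. ennreal (K (norm x) * \<bar>u x\<bar> powr q) * indicator A x \<partial>lborel)"

lemma weighted_int_mono_Un:
  fixes u :: "'a::euclidean_space \<Rightarrow> real"
  assumes K: "continuous_on {0<..} K" and [measurable]: "u \<in> borel_measurable borel" "A \<in> sets borel" "B \<in> sets borel"
    and "X \<subseteq> A \<union> B"
  shows "weighted_int q K X u \<le> weighted_int q K A u + weighted_int q K B u"
proof -
  note [measurable] = measurable_comp_norm[OF K, where 'a='a]
  let ?f = "\<lambda>x. ennreal (K (norm x) * \<bar>u x\<bar> powr q)"
  have "weighted_int q K X u \<le> (\<integral>\<^sup>+ x. ?f x * indicator A x + ?f x * indicator B x \<partial>lborel)"
    unfolding weighted_int_def using assms(5) by (intro nn_integral_mono) (auto simp: indicator_def)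
  also have "\<dots> = weighted_int q K A u + weighted_int q K B u"
    unfolding weighted_int_def by (rule nn_integral_add) measurable
  finally show ?thesis .
qed

lemma weighted_int_cmult:
  fixes u :: "'a::euclidean_space \<Rightarrow> real"
  assumes K: "continuous_on {0<..} K" and [measurable]: "u \<in> borel_measurable borel" "A \<in> sets borel"
  shows "weighted_int q K A (\<lambda>x. a * u x) = ennreal (\<bar>a\<bar> powr q) * weighted_int q K A u"
proof -
  note [measurable] = measurable_comp_norm[OF K, where 'a='a]
  have "weighted_int q K A (\<lambda>x. a * u x) = (\<integral>\<^sup>+ x. ennreal (\<bar>a\<bar> powr q) * (ennreal (K (norm x) * \<bar>u x\<bar> powr q) * indicator A x) \<partial>lborel)"
    unfolding weighted_int_def
    by (simp add: ennreal_mult'[symmetric] abs_mult powr_mult mult.assoc[symmetric]) (simp add: mult_ac)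
  also have "\<dots> = ennreal (\<bar>a\<bar> powr q) * weighted_int q K A u"
    unfolding weighted_int_def by (rule nn_integral_cmult) measurable
  finally show ?thesis .
qed

lemma weighted_int_Fatou:
  fixes h :: "nat \<Rightarrow> 'a::euclidean_space \<Rightarrow> real"
  assumes K: "continuous_on {0<..} K" and [measurable]: "\<And>m. h m \<in> borel_measurable borel" "A \<in> sets borel"
    and q: "0 < q" and lim: "AE x in lborel. (\<lambda>m. h m x) \<longlonglongrightarrow> w x" and b: "\<And>m. weighted_int q K A (h m) \<le> b"
  shows "weighted_int q K A w \<le> b"
proof -
  note [measurable] = measurable_comp_norm[OF K, where 'a='a]
  let ?f = "\<lambda>u x. ennreal (K (norm x) * \<bar>u x\<bar> powr q) * indicator A x"
  have "AE x in lborel. ?f w x \<le> liminf (\<lambda>m. ?f (h m) x)"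
    using lim
  proof eventually_elim
    case (elim x)
    \<comment> \<open>Positivity of \<open>q\<close> gives continuity of the power also where the
      limit is zero.\<close>
    have "(\<lambda>m. \<bar>h m x\<bar> powr q) \<longlonglongrightarrow> \<bar>w x\<bar> powr q"
      by (rule tendsto_powr') (use elim q in \<open>auto intro: tendsto_rabs\<close>)
    then have "(\<lambda>m. ennreal (K (norm x) * \<bar>h m x\<bar> powr q)) \<longlonglongrightarrow> ennreal (K (norm x) * \<bar>w x\<bar> powr q)"
      by (intro tendsto_ennrealI tendsto_mult tendsto_const)
    then have "(\<lambda>m. ?f (h m) x) \<longlonglongrightarrow> ?f w x" by (cases "x \<in> A") auto
    then show ?case by (simp add: lim_imp_Liminf)
  qed
  then have "weighted_int q K A w \<le> (\<integral>\<^sup>+ x. liminf (\<lambda>m. ?f (h m) x) \<partial>lborel)"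
    unfolding weighted_int_def by (rule nn_integral_mono_AE)
  also have "\<dots> \<le> liminf (\<lambda>m. weighted_int q K A (h m))"
    unfolding weighted_int_def by (rule nn_integral_liminf) measurable
  also have "\<dots> \<le> b" by (rule Liminf_le) (use b in auto)
  finally show ?thesis .
qed

text \<open>A function of norm zero cannot be normalised; the pointwise bound, valid for every \<open>M > 0\<close>, shows that it vanishes.\<close>

lemma HsV_rad_weighted_int_scale:
  fixes u :: "'a::euclidean_space \<Rightarrow> real"
  assumes N: "DIM('a) \<ge> 2" and s: "1/2 < s" "s < 1" and q: "0 < q"
    and V: "continuous_on {0<..} V" and K: "continuous_on {0<..} K" and A [measurable]: "A \<in> sets borel"
    and u: "u \<in> HsV_rad s V" "HsV_norm s V u \<le> M"
    and b: "\<And>v::'a \<Rightarrow> real. v \<in> HsV_rad s V \<Longrightarrow> HsV_norm s V v = 1 \<Longrightarrow> weighted_int q K A v \<le> b"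
  shows "weighted_int q K A u \<le> ennreal (M powr q) * b"
proof (cases "HsV_norm s V u = 0")
  case True
  \<comment> \<open>The bound is used with \<open>M = inverse (real (Suc n))\<close> for every
    \<open>n\<close>. \<open>SOME\<close> names a constant depending on \<open>i\<close> alone, so
    that countably many null sets can be united.\<close>
  have "AE x in lborel. \<forall>i n. inverse (real (Suc i)) < norm x \<longrightarrow> real (Suc n) * \<bar>u x\<bar> \<le> (SOME C::real. \<forall>n. AE x in lborel. inverse (real (Suc i)) < norm x \<longrightarrow> real (Suc n) * \<bar>u x\<bar> \<le> C)"
  proof (subst AE_all_countable, intro allI, subst AE_all_countable)
    fix i
    obtain C where C: "\<And>(u::'a \<Rightarrow> real) M. u \<in> HsV_rad s V \<Longrightarrow> HsV_norm s V u \<le> M \<Longrightarrow> 0 < M \<Longrightarrow>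
     (AE x in lborel. inverse (real (Suc i)) < norm x \<longrightarrow> \<bar>u x\<bar> \<le> C * M)"
      using HsV_rad_AE_bound[OF N s, of "inverse (real (Suc i))" V] by auto
    have "\<forall>n. AE x in lborel. inverse (real (Suc i)) < norm x \<longrightarrow> real (Suc n) * \<bar>u x\<bar> \<le> C"
      using C[OF u(1), of "inverse (real (Suc _))"] True by (simp add: field_simps)
    then show "\<forall>n. AE x in lborel. inverse (real (Suc i)) < norm x \<longrightarrow> real (Suc n) * \<bar>u x\<bar> \<le> (SOME C::real. \<forall>n. AE x in lborel. inverse (real (Suc i)) < norm x \<longrightarrow> real (Suc n) * \<bar>u x\<bar> \<le> C)"
      by (rule someI)
  qed
  then have "AE x in lborel. u x = 0"
    using AE_nonzero
  proof eventually_elim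
    case (elim x)
    then obtain i where "inverse (real (Suc i)) < norm x" using reals_Archimedean[of "norm x"] by auto
    then obtain C where C: "\<And>n. real (Suc n) * \<bar>u x\<bar> \<le> C" using elim by blast
    show ?case
    proof (rule ccontr)
      assume "u x \<noteq> 0"
      then obtain n where "C < real n * \<bar>u x\<bar>" using reals_Archimedean3[of "\<bar>u x\<bar>"] by auto
      moreover have "real n * \<bar>u x\<bar> \<le> real (Suc n) * \<bar>u x\<bar>" by (intro mult_right_mono) auto
      ultimately show False using C[of n] by linarith
    qed
  qed
  then have "weighted_int q K A u = (\<integral>\<^sup>+ x. 0 \<partial>(lborel :: 'a measure))"
    unfolding weighted_int_def by (intro nn_integral_cong_AE) (auto elim: eventually_mono)
  then show ?thesis by simp
next
  case False
  define a where "a = HsV_norm s V u"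
  have a: "0 < a" "a \<le> M" using False HsV_norm_nonneg[of s V u] u(2) by (auto simp: a_def)
  let ?v = "\<lambda>x. inverse a * u x"
  have v: "?v \<in> HsV_rad s V" "HsV_norm s V ?v = 1"
    using HsV_rad_cmult[OF V u(1), of "inverse a"] a by (auto simp: a_def)
  have "u = (\<lambda>x. a * ?v x)" using a by auto
  then have "weighted_int q K A u = ennreal (\<bar>a\<bar> powr q) * weighted_int q K A ?v"
    using weighted_int_cmult[OF K HsV_radD(1)[OF v(1)] A, of q a] by simp
  also have "\<dots> \<le> ennreal (M powr q) * b"
    using a q by (intro mult_mono b v ennreal_leI powr_mono2) auto
  finally show ?thesis .
qed

section \<open>The sum space and the embedding\<close>

text \<open>Cutting \<open>w\<close> at radius \<open>R\<close> gives one admissible decomposition,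
  hence an upper bound for the infimum. Nonnegativity of all candidates makes the infimum well
  behaved.\<close>

lemma LqK_sum_norm_bounds:
  fixes w :: "'a::euclidean_space \<Rightarrow> real"
  assumes [measurable]: "w \<in> borel_measurable borel" and q: "0 < q1" "0 < q2" and AB: "0 \<le> A" "0 \<le> B"
    and 1: "weighted_int q1 K (ball 0 R) w \<le> ennreal A" and 2: "weighted_int q2 K (- ball 0 R) w \<le> ennreal B"
  shows "w \<in> LqK_sum q1 q2 K" and "0 \<le> LqK_sum_norm q1 q2 K w"
    and "LqK_sum_norm q1 q2 K w \<le> max (A powr (1 / q1)) (B powr (1 / q2))"
proof -
  define w1 where "w1 x = indicator (ball 0 R) x * w x" for x
  define w2 where "w2 x = indicator (- ball 0 R) x * w x" for x
  have [measurable]: "ball (0::'a) R \<in> sets borel" by simp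
  have [measurable]: "w1 \<in> borel_measurable borel" "w2 \<in> borel_measurable borel"
    unfolding w1_def w2_def by measurable
  have w: "w = (\<lambda>x. w1 x + w2 x)" by (auto simp: w1_def w2_def indicator_def)
  have e1: "(\<integral>\<^sup>+ x. ennreal (K (norm x) * \<bar>w1 x\<bar> powr q1) \<partial>lborel) = weighted_int q1 K (ball 0 R) w"
    unfolding weighted_int_def w1_def using q by (intro nn_integral_cong) (auto simp: indicator_def)
  have e2: "(\<integral>\<^sup>+ x. ennreal (K (norm x) * \<bar>w2 x\<bar> powr q2) \<partial>lborel) = weighted_int q2 K (- ball 0 R) w"
    unfolding weighted_int_def w2_def using q by (intro nn_integral_cong) (auto simp: indicator_def)
  have L: "w1 \<in> LqK q1 K" "w2 \<in> LqK q2 K"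
    unfolding LqK_def using e1 e2 1 2 by (auto simp: order_le_less_trans)
  let ?X = "{max (LqK_norm q1 K u1) (LqK_norm q2 K u2) | u1 u2. u1 \<in> LqK q1 K \<and> u2 \<in> LqK q2 K \<and> w = (\<lambda>x. u1 x + u2 x)}"
  have mem: "max (LqK_norm q1 K w1) (LqK_norm q2 K w2) \<in> ?X" using L w by blast
  have nonneg: "0 \<le> z" if "z \<in> ?X" for z using that by (auto simp: LqK_norm_def max_def)
  show "w \<in> LqK_sum q1 q2 K" unfolding LqK_sum_def using L w by blast
  show "0 \<le> LqK_sum_norm q1 q2 K w"
    unfolding LqK_sum_norm_def using mem nonneg by (intro cInf_greatest) auto
  have "LqK_sum_norm q1 q2 K w \<le> max (LqK_norm q1 K w1) (LqK_norm q2 K w2)"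
    unfolding LqK_sum_norm_def by (rule cInf_lower[OF mem], rule bdd_belowI[of _ 0], rule nonneg)
  moreover have "LqK_norm q1 K w1 \<le> A powr (1 / q1)"
    unfolding LqK_norm_def e1 using 1 AB q by (intro powr_mono2) (auto intro: enn2real_leI)
  moreover have "LqK_norm q2 K w2 \<le> B powr (1 / q2)"
    unfolding LqK_norm_def e2 using 2 AB q by (intro powr_mono2) (auto intro: enn2real_leI)
  ultimately show "LqK_sum_norm q1 q2 K w \<le> max (A powr (1 / q1)) (B powr (1 / q2))" by linarith
qed

section \<open>Uniform estimates near the origin, on annuli and near infinity\<close>

locale vanishing_weights =
  fixes T :: "'a::euclidean_space itself" and V K :: "real \<Rightarrow> real" and s q1 q2 :: real
  assumes N: "DIM('a) \<ge> 2" and s: "1/2 < s" "s < 1" and q: "1 < q1" "1 < q2"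
    and V: "continuous_on {0<..} V" "\<And>t. t > 0 \<Longrightarrow> V t \<ge> 0"
    and K: "continuous_on {0<..} K" "\<And>t. t > 0 \<Longrightarrow> K t > 0"
    and S0: "((\<lambda>R. S0 TYPE('a) s V K q1 R) \<longlongrightarrow> 0) (at_right 0)"
    and Sinf: "((\<lambda>R. Sinf TYPE('a) s V K q2 R) \<longlongrightarrow> 0) at_top"
begin

lemma qpos: "0 < q1" "0 < q2" using q by auto

text \<open>The supremum controls unit vectors, and homogeneity of degree \<open>q1\<close> extends
  this to all functions; hence one radius serves every \<open>M\<close>.\<close>

lemma inner_small:
  assumes "0 < e"
  shows "\<exists>R>0. \<forall>(u::'a \<Rightarrow> real) M. u \<in> HsV_rad s V \<longrightarrow> HsV_norm s V u \<le> M \<longrightarrow>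
    weighted_int q1 K (ball 0 R) u \<le> ennreal (M powr q1 * e)"
proof -
  have "eventually (\<lambda>R. S0 TYPE('a) s V K q1 R < ennreal e) (at_right 0)"
    by (rule order_tendstoD(2)[OF S0]) (use assms in simp)
  then obtain b where b: "0 < b" "\<And>R. 0 < R \<Longrightarrow> R < b \<Longrightarrow> S0 TYPE('a) s V K q1 R < ennreal e"
    unfolding eventually_at_right_field by blast
  define R where "R = b / 2"
  have R: "0 < R" "S0 TYPE('a) s V K q1 R < ennreal e" using b by (auto simp: R_def)
  have "weighted_int q1 K (ball 0 R) v \<le> ennreal e" if "v \<in> HsV_rad s V" "HsV_norm s V v = 1" for v :: "'a \<Rightarrow> real"
  proof -
    have "weighted_int q1 K (ball 0 R) v \<le> S0 TYPE('a) s V K q1 R"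
      unfolding S0_def weighted_int_def by (rule Sup_upper) (use that in blast)
    then show ?thesis using R(2) by simp
  qed
  then have "weighted_int q1 K (ball 0 R) u \<le> ennreal (M powr q1) * ennreal e"
    if "u \<in> HsV_rad s V" "HsV_norm s V u \<le> M" for u :: "'a \<Rightarrow> real" and M
    using that by (intro HsV_rad_weighted_int_scale[OF N s qpos(1) V(1) K(1)]) auto
  then show ?thesis using R(1) assms by (auto simp: ennreal_mult'')
qed

lemma tail_small:
  assumes "0 < e"
  shows "\<exists>R>R0. \<forall>(u::'a \<Rightarrow> real) M. u \<in> HsV_rad s V \<longrightarrow> HsV_norm s V u \<le> M \<longrightarrow>
    weighted_int q2 K (- ball 0 R) u \<le> ennreal (M powr q2 * e)"
proof -
  have "eventually (\<lambda>R. Sinf TYPE('a) s V K q2 R < ennreal e) at_top"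
    by (rule order_tendstoD(2)[OF Sinf]) (use assms in simp)
  then have "eventually (\<lambda>R. R0 < R \<and> Sinf TYPE('a) s V K q2 R < ennreal e) at_top"
    by (intro eventually_conj eventually_gt_at_top)
  then obtain R where R: "R0 < R" "Sinf TYPE('a) s V K q2 R < ennreal e"
    unfolding eventually_at_top_linorder by blast
  have "weighted_int q2 K (- ball 0 R) v \<le> ennreal e" if "v \<in> HsV_rad s V" "HsV_norm s V v = 1" for v :: "'a \<Rightarrow> real"
  proof -
    have "weighted_int q2 K (- ball 0 R) v \<le> Sinf TYPE('a) s V K q2 R"
      unfolding Sinf_def weighted_int_def by (rule Sup_upper) (use that in blast)
    then show ?thesis using R(2) by simp
  qed
  then have "weighted_int q2 K (- ball 0 R) u \<le> ennreal (M powr q2) * ennreal e"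
    if "u \<in> HsV_rad s V" "HsV_norm s V u \<le> M" for u :: "'a \<Rightarrow> real" and M
    using that by (intro HsV_rad_weighted_int_scale[OF N s qpos(2) V(1) K(1)]) auto
  then show ?thesis using R(1) assms by (auto simp: ennreal_mult'')
qed

lemma K_bounded_annulus:
  assumes "0 < R"
  shows "\<exists>k>0. \<forall>t. R \<le> t \<longrightarrow> t \<le> R' \<longrightarrow> K t \<le> k"
proof -
  have "compact (K ` {R..R'})"
    using assms by (intro compact_continuous_image continuous_on_subset[OF K(1)]) auto
  then obtain k where "\<forall>y\<in>K ` {R..R'}. norm y \<le> k" using compact_imp_bounded bounded_iff by metis
  then show ?thesis by (intro exI[of _ "max k 1"]) (force simp: max_def)
qed

text \<open>The domination is stated for every \<open>w\<close> with the pointwise bound, not only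
  for members of the space, because it is also needed for differences with the limit function. The
  radius \<open>R / 2\<close> lets the strict inequality cover the sphere of radius
  \<open>R\<close>.\<close>

lemma annulus_dominated:
  assumes R: "0 < R"
  shows "\<exists>C>0. \<exists>k>0. (\<forall>(u::'a \<Rightarrow> real) M. u \<in> HsV_rad s V \<longrightarrow> HsV_norm s V u \<le> M \<longrightarrow> 0 < M \<longrightarrow>
      (AE x in lborel. R / 2 < norm x \<longrightarrow> \<bar>u x\<bar> \<le> C * M)) \<and>
    (\<forall>(w::'a \<Rightarrow> real) M. (AE x in lborel. R / 2 < norm x \<longrightarrow> \<bar>w x\<bar> \<le> C * M) \<longrightarrow>
      (AE x in lborel. ennreal (K (norm x) * \<bar>w x\<bar> powr q2) * indicator (cball 0 R' - ball 0 R) x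
         \<le> ennreal (k * (C * M) powr q2) * indicator (cball 0 R') x))"
proof -
  obtain C where C: "C > 0" "\<And>(u::'a \<Rightarrow> real) M. u \<in> HsV_rad s V \<Longrightarrow> HsV_norm s V u \<le> M \<Longrightarrow> 0 < M \<Longrightarrow>
     (AE x in lborel. R / 2 < norm x \<longrightarrow> \<bar>u x\<bar> \<le> C * M)"
    using HsV_rad_AE_bound[OF N s half_gt_zero[OF R]] by blast
  obtain k where k: "k > 0" "\<And>t. R \<le> t \<Longrightarrow> t \<le> R' \<Longrightarrow> K t \<le> k" using K_bounded_annulus[OF R] by blast
  have "AE x in lborel. ennreal (K (norm x) * \<bar>w x\<bar> powr q2) * indicator (cball 0 R' - ball 0 R) x
         \<le> ennreal (k * (C * M) powr q2) * indicator (cball 0 R') x"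
    if "AE x in lborel. R / 2 < norm x \<longrightarrow> \<bar>w x\<bar> \<le> C * M" for w :: "'a \<Rightarrow> real" and M
    using that
  proof eventually_elim
    case (elim x)
    show ?case
    proof (cases "x \<in> cball 0 R' - ball 0 R")
      case True
      then have x: "R \<le> norm x" "norm x \<le> R'" by auto
      then have "\<bar>w x\<bar> powr q2 \<le> (C * M) powr q2" using elim R qpos by (intro powr_mono2) auto
      then have "K (norm x) * \<bar>w x\<bar> powr q2 \<le> k * (C * M) powr q2" using k x by (intro mult_mono) auto
      then show ?thesis using True by (simp add: ennreal_leI)
    qed simp
  qed
  then show ?thesis using C k(1) by (intro exI[of _ C] exI[of _ k] conjI) auto
qed

lemma weighted_int_outer_split:
  fixes u :: "'a \<Rightarrow> real"
  assumes "u \<in> borel_measurable borel"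
  shows "weighted_int q K (- ball 0 R) u \<le> weighted_int q K (cball 0 R' - ball 0 R) u + weighted_int q K (- ball 0 R') u"
  by (rule weighted_int_mono_Un[OF K(1) assms]) auto

lemma nn_integral_const_cball:
  "0 \<le> c \<Longrightarrow> (\<integral>\<^sup>+ x. ennreal c * indicator (cball 0 R') x \<partial>(lborel :: 'a measure)) = ennreal (c * measure lborel (cball (0::'a) R'))"
  using emeasure_eq_ennreal_measure[OF less_imp_neq[OF emeasure_bounded_finite[OF bounded_cball, of "0::'a" R', unfolded infinity_ennreal_def]]]
  by (simp add: nn_integral_cmult_indicator ennreal_mult'')

text \<open>The radius \<open>R\<close> is dictated by the estimate near the origin, while the tail
  is controlled only beyond some \<open>R'\<close>. The gap is filled by the bound on
  \<open>u\<close> and the boundedness of \<open>K\<close> on the annulus.\<close>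

lemma outer_bounded:
  assumes R: "0 < R"
  shows "\<exists>D\<ge>0. \<forall>(u::'a \<Rightarrow> real) M. u \<in> HsV_rad s V \<longrightarrow> HsV_norm s V u \<le> M \<longrightarrow> 0 < M \<longrightarrow>
    weighted_int q2 K (- ball 0 R) u \<le> ennreal (M powr q2 * D)"
proof -
  obtain R' where R': "\<And>(u::'a \<Rightarrow> real) M. u \<in> HsV_rad s V \<Longrightarrow> HsV_norm s V u \<le> M \<Longrightarrow>
    weighted_int q2 K (- ball 0 R') u \<le> ennreal (M powr q2 * 1)"
    using tail_small[of 1 0] by auto
  obtain C k where C: "C > 0" and k: "k > 0"
    and bd: "\<And>(u::'a \<Rightarrow> real) M. u \<in> HsV_rad s V \<Longrightarrow> HsV_norm s V u \<le> M \<Longrightarrow> 0 < M \<Longrightarrow>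
      AE x in lborel. R / 2 < norm x \<longrightarrow> \<bar>u x\<bar> \<le> C * M"
    and dom: "\<And>(w::'a \<Rightarrow> real) M. (AE x in lborel. R / 2 < norm x \<longrightarrow> \<bar>w x\<bar> \<le> C * M) \<Longrightarrow>
      AE x in lborel. ennreal (K (norm x) * \<bar>w x\<bar> powr q2) * indicator (cball 0 R' - ball 0 R) x
         \<le> ennreal (k * (C * M) powr q2) * indicator (cball 0 R') x"
    using annulus_dominated[OF R, of R'] by blast
  define D where "D = k * C powr q2 * measure lborel (cball (0::'a) R') + 1"
  have D: "0 \<le> D" using k by (simp add: D_def)
  have "weighted_int q2 K (- ball 0 R) u \<le> ennreal (M powr q2 * D)"
    if u: "u \<in> HsV_rad s V" "HsV_norm s V u \<le> M" "0 < M" for u :: "'a \<Rightarrow> real" and M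
  proof -
    have "weighted_int q2 K (cball 0 R' - ball 0 R) u \<le> (\<integral>\<^sup>+ x. ennreal (k * (C * M) powr q2) * indicator (cball 0 R') x \<partial>(lborel :: 'a measure))"
      unfolding weighted_int_def by (rule nn_integral_mono_AE[OF dom[OF bd[OF u]]])
    also have "\<dots> = ennreal (k * (C * M) powr q2 * measure lborel (cball (0::'a) R'))"
      by (rule nn_integral_const_cball) (use k in simp)
    finally have "weighted_int q2 K (- ball 0 R) u \<le> ennreal (k * (C * M) powr q2 * measure lborel (cball (0::'a) R')) + ennreal (M powr q2 * 1)"
      using weighted_int_outer_split[OF HsV_radD(1)[OF u(1)], of q2 R R'] R'[OF u(1,2)] by (meson add_mono order_trans)
    also have "\<dots> = ennreal (k * (C * M) powr q2 * measure lborel (cball (0::'a) R') + M powr q2 * 1)"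
      using k by (intro ennreal_plus[symmetric]) auto
    also have "k * (C * M) powr q2 * measure lborel (cball (0::'a) R') + M powr q2 * 1 = M powr q2 * D"
      using C u(3) by (simp add: D_def powr_mult algebra_simps)
    finally show ?thesis .
  qed
  then show ?thesis using D by blast
qed

section \<open>Continuity and compactness of the embedding\<close>

lemma embedding_bounds:
  "\<exists>C. \<forall>u::'a \<Rightarrow> real. u \<in> HsV_rad s V \<longrightarrow> u \<in> LqK_sum q1 q2 K \<and> LqK_sum_norm q1 q2 K u \<le> C * HsV_norm s V u"
proof -
  obtain R where R: "0 < R" and inner: "\<And>(u::'a \<Rightarrow> real) M. u \<in> HsV_rad s V \<Longrightarrow> HsV_norm s V u \<le> M \<Longrightarrow>
    weighted_int q1 K (ball 0 R) u \<le> ennreal (M powr q1 * 1)"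
    using inner_small[of 1] by auto
  obtain D where D: "D \<ge> 0" and outer: "\<And>(u::'a \<Rightarrow> real) M. u \<in> HsV_rad s V \<Longrightarrow> HsV_norm s V u \<le> M \<Longrightarrow> 0 < M \<Longrightarrow>
    weighted_int q2 K (- ball 0 R) u \<le> ennreal (M powr q2 * D)"
    using outer_bounded[OF R] by blast
  define C where "C = max 1 (D powr (1 / q2))"
  have C0: "C > 0" unfolding C_def by (rule less_le_trans[OF zero_less_one max.cobounded1])
  have main: "u \<in> LqK_sum q1 q2 K \<and> LqK_sum_norm q1 q2 K u \<le> C * M"
    if u: "u \<in> HsV_rad s V" "HsV_norm s V u \<le> M" "0 < M" for u :: "'a \<Rightarrow> real" and M
  proof -
    note b = LqK_sum_norm_bounds[OF HsV_radD(1)[OF u(1)] qpos _ _ inner[OF u(1,2)] outer[OF u]]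
    have "(M powr q1 * 1) powr (1 / q1) = M" "(M powr q2 * D) powr (1 / q2) = M * D powr (1 / q2)"
      using u(3) D qpos by (simp_all add: powr_mult powr_powr)
    then have "LqK_sum_norm q1 q2 K u \<le> max M (M * D powr (1 / q2))" using b(3) D by simp
    also have "\<dots> = C * M" using u(3) by (simp add: C_def max_def mult.commute mult_le_cancel_left1)
    finally show ?thesis using b(1) D by simp
  qed
  have "u \<in> LqK_sum q1 q2 K \<and> LqK_sum_norm q1 q2 K u \<le> C * HsV_norm s V u" if u: "u \<in> HsV_rad s V" for u :: "'a \<Rightarrow> real"
  proof
    show "u \<in> LqK_sum q1 q2 K" using main[OF u, of "HsV_norm s V u + 1"] HsV_norm_nonneg[of s V u] by simp
    show "LqK_sum_norm q1 q2 K u \<le> C * HsV_norm s V u"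
    proof (rule field_le_epsilon)
      \<comment> \<open>The outer estimate requires \<open>0 < M\<close>, whereas the norm may
        vanish; hence \<open>M\<close> exceeds the norm by \<open>d / C\<close>.\<close>
      fix d :: real assume "0 < d"
      then have "LqK_sum_norm q1 q2 K u \<le> C * (HsV_norm s V u + d / C)"
        using main[OF u, of "HsV_norm s V u + d / C"] HsV_norm_nonneg[of s V u] C0 by (simp add: add_nonneg_pos)
      then show "LqK_sum_norm q1 q2 K u \<le> C * HsV_norm s V u + d" using C0 by (simp add: distrib_left)
    qed
  qed
  then show ?thesis by blast
qed

lemma compactness:
  fixes f :: "nat \<Rightarrow> 'a \<Rightarrow> real"
  assumes f: "\<And>n. f n \<in> HsV_rad s V" and bounded: "bounded (range (\<lambda>n. HsV_norm s V (f n)))"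
  shows "\<exists>r u. strict_mono r \<and> u \<in> LqK_sum q1 q2 K \<and> (\<lambda>n. LqK_sum_norm q1 q2 K (\<lambda>x. f (r n) x - u x)) \<longlonglongrightarrow> 0"
proof -
  obtain M where M: "0 < M" "\<And>n. HsV_norm s V (f n) \<le> M"
  proof -
    obtain M where M: "0 < M" "\<forall>x\<in>range (\<lambda>n. HsV_norm s V (f n)). norm x \<le> M"
      using bounded unfolding bounded_pos by blast
    then have "HsV_norm s V (f n) \<le> M" for n by (auto intro: order_trans[OF abs_ge_self])
    with M(1) show ?thesis using that by blast
  qed
  have "\<exists>r. strict_mono r \<and> (AE x in lborel. convergent (\<lambda>n. f (r n) x))"
    by (rule HsV_rad_AE_convergent_subsequence[OF N s f M(2) M(1)])
  then obtain r where r: "strict_mono r" and conv: "AE x in lborel. convergent (\<lambda>n. f (r n) x)"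
    by (elim exE conjE)
  define g where "g n = f (r n)" for n
  have g: "\<And>n. g n \<in> HsV_rad s V" "\<And>n. HsV_norm s V (g n) \<le> M" using f M(2) by (auto simp: g_def)
  have gm [measurable]: "\<And>n. g n \<in> borel_measurable borel" by (rule HsV_radD(1)[OF g(1)])
  \<comment> \<open>Where the sequence diverges the value is arbitrary, but \<open>u\<close> is
    Borel measurable everywhere, as membership in the sum space demands.\<close>
  define u where "u x = lim (\<lambda>n. g n x)" for x
  have um [measurable]: "u \<in> borel_measurable borel" unfolding u_def by measurable
  have lim: "AE x in lborel. (\<lambda>n. g n x) \<longlonglongrightarrow> u x"
    using conv unfolding u_def g_def by eventually_elim (simp add: convergent_LIMSEQ_iff)
  define w where "w n x = g n x - u x" for n x
  have wm [measurable]: "w n \<in> borel_measurable borel" for n unfolding w_def by measurable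
  have N': "2 * s < real DIM('a)" using N s by linarith
  have d: "(\<lambda>x. g n x - g m x) \<in> HsV_rad s V" "HsV_norm s V (\<lambda>x. g n x - g m x) \<le> 2 * M" for n m
    using HsV_rad_diff[OF V N' g(1)[of n] g(1)[of m]] g(2) by auto
  \<comment> \<open>With \<open>n\<close> fixed, \<open>w n\<close> is a limit of members of the
    space of norm at most \<open>2 * M\<close>; all bounds on \<open>w n\<close> are inherited from
    them.\<close>
  have limd: "AE x in lborel. (\<lambda>m. g n x - g m x) \<longlonglongrightarrow> w n x" for n
    using lim unfolding w_def by eventually_elim (intro tendsto_intros)
  have "u \<in> LqK_sum q1 q2 K"
  proof -
    obtain R where R: "0 < R" and inner: "\<And>(u::'a \<Rightarrow> real) M. u \<in> HsV_rad s V \<Longrightarrow> HsV_norm s V u \<le> M \<Longrightarrow>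
      weighted_int q1 K (ball 0 R) u \<le> ennreal (M powr q1 * 1)"
      using inner_small[of 1] by auto
    obtain D where D: "D \<ge> 0" and outer: "\<And>(u::'a \<Rightarrow> real) M. u \<in> HsV_rad s V \<Longrightarrow> HsV_norm s V u \<le> M \<Longrightarrow> 0 < M \<Longrightarrow>
      weighted_int q2 K (- ball 0 R) u \<le> ennreal (M powr q2 * D)"
      using outer_bounded[OF R] by blast
    have "weighted_int q1 K (ball 0 R) u \<le> ennreal (M powr q1 * 1)"
      by (rule weighted_int_Fatou[OF K(1) gm _ qpos(1) lim inner[OF g]]) simp
    moreover have "weighted_int q2 K (- ball 0 R) u \<le> ennreal (M powr q2 * D)"
      by (rule weighted_int_Fatou[OF K(1) gm _ qpos(2) lim outer[OF g M(1)]]) simp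
    ultimately show ?thesis using LqK_sum_norm_bounds(1)[OF um qpos] D by (metis mult_nonneg_nonneg powr_ge_zero zero_le_one)
  qed
  moreover have "(\<lambda>n. LqK_sum_norm q1 q2 K (w n)) \<longlonglongrightarrow> 0"
  proof (rule tendstoI)
    fix \<epsilon>' :: real assume "0 < \<epsilon>'"
    define \<epsilon> where "\<epsilon> = \<epsilon>' / 2"
    have \<epsilon>: "0 < \<epsilon>" "\<epsilon> < \<epsilon>'" using \<open>0 < \<epsilon>'\<close> by (auto simp: \<epsilon>_def)
    \<comment> \<open>The inner part may use all of \<open>\<epsilon> powr q1\<close>. The tail gets
      only half of \<open>\<epsilon> powr q2\<close>, the other half being reserved for the
      annulus.\<close>
    define d1 where "d1 = \<epsilon> powr q1 / (2 * M) powr q1"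
    define d2 where "d2 = \<epsilon> powr q2 / 2 / (2 * M) powr q2"
    have d12: "d1 > 0" "d2 > 0" using \<epsilon> M by (auto simp: d1_def d2_def)
    have dM: "(2 * M) powr q1 * d1 = \<epsilon> powr q1" "(2 * M) powr q2 * d2 = \<epsilon> powr q2 / 2"
      using M by (auto simp: d1_def d2_def)
    obtain R where R: "0 < R" and inner: "\<And>(u::'a \<Rightarrow> real) M. u \<in> HsV_rad s V \<Longrightarrow> HsV_norm s V u \<le> M \<Longrightarrow>
      weighted_int q1 K (ball 0 R) u \<le> ennreal (M powr q1 * d1)"
      using inner_small[OF d12(1)] by blast
    obtain R' where tail: "\<And>(u::'a \<Rightarrow> real) M. u \<in> HsV_rad s V \<Longrightarrow> HsV_norm s V u \<le> M \<Longrightarrow>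
      weighted_int q2 K (- ball 0 R') u \<le> ennreal (M powr q2 * d2)"
      using tail_small[OF d12(2)] by blast
    \<comment> \<open>The bounds \<open>A\<close> and \<open>B\<close> hold for every
      \<open>n\<close>; only the annulus requires \<open>n\<close> to be large.\<close>
    have A: "weighted_int q1 K (ball 0 R) (w n) \<le> ennreal (\<epsilon> powr q1)" for n
      unfolding dM(1)[symmetric]
      by (rule weighted_int_Fatou[OF K(1) _ _ qpos(1) limd inner[OF d]]) auto
    have B: "weighted_int q2 K (- ball 0 R') (w n) \<le> ennreal (\<epsilon> powr q2 / 2)" for n
      unfolding dM(2)[symmetric]
      by (rule weighted_int_Fatou[OF K(1) _ _ qpos(2) limd tail[OF d]]) auto
    have "(\<lambda>n. weighted_int q2 K (cball 0 R' - ball 0 R) (w n)) \<longlonglongrightarrow> (\<integral>\<^sup>+ x. 0 \<partial>(lborel :: 'a measure))"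
    proof -
      obtain C k where C: "C > 0" and k: "k > 0"
        and bd: "\<And>(u::'a \<Rightarrow> real) M. u \<in> HsV_rad s V \<Longrightarrow> HsV_norm s V u \<le> M \<Longrightarrow> 0 < M \<Longrightarrow>
          AE x in lborel. R / 2 < norm x \<longrightarrow> \<bar>u x\<bar> \<le> C * M"
        and dom: "\<And>(w::'a \<Rightarrow> real) M. (AE x in lborel. R / 2 < norm x \<longrightarrow> \<bar>w x\<bar> \<le> C * M) \<Longrightarrow>
          AE x in lborel. ennreal (K (norm x) * \<bar>w x\<bar> powr q2) * indicator (cball 0 R' - ball 0 R) x
             \<le> ennreal (k * (C * M) powr q2) * indicator (cball 0 R') x"
        using annulus_dominated[OF R, of R'] by blast
      have dbound: "AE x in lborel. \<forall>m. R / 2 < norm x \<longrightarrow> \<bar>g n x - g m x\<bar> \<le> C * (2 * M)" for n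
        using bd[OF d] M(1) by (subst AE_all_countable) auto
      have wb: "AE x in lborel. R / 2 < norm x \<longrightarrow> \<bar>w n x\<bar> \<le> C * (2 * M)" for n
        using dbound[of n] limd[of n]
      proof eventually_elim
        case (elim x)
        show ?case
        proof
          assume "R / 2 < norm x"
          then have "\<And>m. \<bar>g n x - g m x\<bar> \<le> C * (2 * M)" using elim(1) by blast
          then show "\<bar>w n x\<bar> \<le> C * (2 * M)"
            by (intro LIMSEQ_le_const2[OF tendsto_rabs[OF elim(2)]]) auto
        qed
      qed
      note [measurable] = measurable_comp_norm[OF K(1), where 'a='a]
      have [measurable]: "ball (0::'a) R \<in> sets borel" "cball (0::'a) R' \<in> sets borel" by simp_all
      show ?thesis
        unfolding weighted_int_def
      proof (rule nn_integral_dominated_convergence[where w = "\<lambda>x. ennreal (k * (C * (2 * M)) powr q2) * indicator (cball 0 R') x"])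
        show "AE x in lborel. ennreal (K (norm x) * \<bar>w n x\<bar> powr q2) * indicator (cball 0 R' - ball 0 R) x
          \<le> ennreal (k * (C * (2 * M)) powr q2) * indicator (cball 0 R') x" for n
          by (rule dom[OF wb])
        show "(\<integral>\<^sup>+ x. ennreal (k * (C * (2 * M)) powr q2) * indicator (cball 0 R') x \<partial>(lborel :: 'a measure)) < \<infinity>"
          by (subst nn_integral_const_cball) (use k in auto)
        show "AE x in lborel. (\<lambda>n. ennreal (K (norm x) * \<bar>w n x\<bar> powr q2) * indicator (cball 0 R' - ball 0 R) x) \<longlonglongrightarrow> 0"
          using lim
        proof eventually_elim
          case (elim x)
          have "(\<lambda>n. w n x) \<longlonglongrightarrow> u x - u x" unfolding w_def using elim by (intro tendsto_intros)
          then have "(\<lambda>n. \<bar>w n x\<bar>) \<longlonglongrightarrow> 0" by (simp add: tendsto_rabs_zero_iff)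
          then have "(\<lambda>n. \<bar>w n x\<bar> powr q2) \<longlonglongrightarrow> 0 powr q2"
            by (rule tendsto_powr') (use qpos in auto)
          then have "(\<lambda>n. ennreal (K (norm x) * \<bar>w n x\<bar> powr q2)) \<longlonglongrightarrow> ennreal (K (norm x) * 0 powr q2)"
            by (intro tendsto_ennrealI tendsto_mult tendsto_const)
          then show ?case by (cases "x \<in> cball 0 R' - ball 0 R") auto
        qed
      qed measurable
    qed
    then have "eventually (\<lambda>n. weighted_int q2 K (cball 0 R' - ball 0 R) (w n) < ennreal (\<epsilon> powr q2 / 2)) sequentially"
      by (rule order_tendstoD(2)) (use \<epsilon> in simp)
    then show "eventually (\<lambda>n. dist (LqK_sum_norm q1 q2 K (w n)) 0 < \<epsilon>') sequentially"
    proof eventually_elim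
      case (elim n)
      have "weighted_int q2 K (- ball 0 R) (w n) \<le> ennreal (\<epsilon> powr q2 / 2) + ennreal (\<epsilon> powr q2 / 2)"
        using weighted_int_outer_split[OF wm, of q2 R n R'] add_mono[OF less_imp_le[OF elim] B[of n]] by (rule order_trans)
      also have "\<dots> = ennreal (\<epsilon> powr q2)" by (subst ennreal_plus[symmetric]) auto
      finally have C: "weighted_int q2 K (- ball 0 R) (w n) \<le> ennreal (\<epsilon> powr q2)" .
      note b = LqK_sum_norm_bounds[OF wm qpos _ _ A C]
      have "LqK_sum_norm q1 q2 K (w n) \<le> \<epsilon>" using b(3) \<epsilon> qpos by (simp add: powr_powr)
      then show ?case using b(2) \<epsilon> by simp
    qed
  qed
  ultimately show ?thesis using r unfolding w_def g_def by blast
qed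

end

theorem theorem3p3:
  fixes V K :: "real \<Rightarrow> real" and s q1 q2 :: real
  assumes "DIM('a::euclidean_space) \<ge> 2"
    and "1/2 < s" and "s < 1"
    and "q1 > 1" and "q2 > 1"
    and "continuous_on {0<..} V" and "\<And>t. t > 0 \<Longrightarrow> V t \<ge> 0"
    and "continuous_on {0<..} K" and "\<And>t. t > 0 \<Longrightarrow> K t > 0"
    and "((\<lambda>R. S0 TYPE('a) s V K q1 R) \<longlongrightarrow> 0) (at_right 0)"
    and "((\<lambda>R. Sinf TYPE('a) s V K q2 R) \<longlongrightarrow> 0) at_top"
  shows "compact_embedding_rad TYPE('a) s V K q1 q2"
proof -
  interpret vanishing_weights "TYPE('a)" V K s q1 q2
    by unfold_locales (use assms in auto)
  show ?thesis
    unfolding compact_embedding_rad_def using embedding_bounds compactness by blast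
qed

end
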